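(* Let $n\geq1$ and let $\mu:[0,\infty)\to[0,\infty)$ be a modulus of continuity satisfying \[ \int_{C_0}^\infty \frac{\mu(s^{-1})}{s}\,ds=\infty \] for a sufficiently large constant $C_0>0$, and assume that $h(s):=s^{1+\frac2n}\mu(s)$ is convex on $[0,\infty)$. Consider \[ u_{tt}-\Delta u+u_t=|u|^{1+\frac2n}\mu(|u|),\quad (t,x)\in(0,\infty)\times\mathbb{R}^n,\qquad u(0,x)=0,\quad u_t(0,x)=g(x), \] with $g\in\mathcal{A}:=H^{\lfloor n/2\rfloor}(\mathbb{R}^n)\cap L^1(\mathbb{R}^n)$ satisfying $\int_{\mathbb{R}^n}g(x)\,dx>0$. Then the problem has no global (in time) Sobolev solution $u\in C([0,\infty),H^1(\mathbb{R}^n)\cap L^\infty(\mathbb{R}^n))$, no matter how small $\|g\|_{\mathcal{A}}$ is.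
   Context: A modulus of continuity is a function $\mu:[0,\infty)\to[0,\infty)$ that is continuous, concave, increasing, and satisfies $\mu(0)=0$. $\lfloor\cdot\rfloor$ is the floor function. A (local) Sobolev solution on $[0,T)$ is a function $u\in C([0,T),H^1\cap L^\infty)$ solving the equation in the mild (Duhamel) sense, hence in the distributional sense, with the given data; global means $T=\infty$. *)

theory Defs
  imports "HOL-Analysis.Analysis"
begin

definition modulus_of_continuity :: "(real \<Rightarrow> real) \<Rightarrow> bool" where
  "modulus_of_continuity \<mu> \<longleftrightarrow>
     continuous_on {0..} \<mu> \<and> concave_on {0..} \<mu> \<and> mono_on {0..} \<mu> \<and>
     \<mu> 0 = 0 \<and> (\<forall>s\<ge>0. \<mu> s \<ge> 0)"

fun dder :: "'a::real_normed_vector list \<Rightarrow> ('a \<Rightarrow> real) \<Rightarrow> 'a \<Rightarrow> real" where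
  "dder [] f = f"
| "dder (v # vs) f = (\<lambda>x. frechet_derivative (dder vs f) (at x) v)"

definition smooth_fun :: "('a::real_normed_vector \<Rightarrow> real) \<Rightarrow> bool" where
  "smooth_fun f \<longleftrightarrow> (\<forall>vs x. dder vs f differentiable (at x))"

definition test_fun :: "('a::euclidean_space \<Rightarrow> real) \<Rightarrow> bool" where
  "test_fun \<phi> \<longleftrightarrow> smooth_fun \<phi> \<and> bounded {x. \<phi> x \<noteq> 0}"

definition L2 :: "('a::euclidean_space \<Rightarrow> real) \<Rightarrow> bool" where
  "L2 f \<longleftrightarrow> f \<in> borel_measurable lborel \<and> integrable lborel (\<lambda>x. (f x)\<^sup>2)"

definition Linf :: "('a::euclidean_space \<Rightarrow> real) \<Rightarrow> bool" where
  "Linf f \<longleftrightarrow> f \<in> borel_measurable lborel \<and> (\<exists>C. AE x in lborel. \<bar>f x\<bar> \<le> C)"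

definition L2_dist :: "('a::euclidean_space \<Rightarrow> real) \<Rightarrow> ('a \<Rightarrow> real) \<Rightarrow> real" where
  "L2_dist f g = sqrt (\<integral>x. (f x - g x)\<^sup>2 \<partial>lborel)"

definition weak_deriv :: "'a::euclidean_space list \<Rightarrow> ('a \<Rightarrow> real) \<Rightarrow> ('a \<Rightarrow> real) \<Rightarrow> bool" where
  "weak_deriv vs f g \<longleftrightarrow>
     (\<forall>\<phi>. test_fun \<phi> \<longrightarrow>
        integrable lborel (\<lambda>x. f x * dder vs \<phi> x) \<and> integrable lborel (\<lambda>x. g x * \<phi> x) \<and>
        (\<integral>x. f x * dder vs \<phi> x \<partial>lborel) = (-1) ^ length vs * (\<integral>x. g x * \<phi> x \<partial>lborel))"

definition sobolev_H :: "nat \<Rightarrow> ('a::euclidean_space \<Rightarrow> real) \<Rightarrow> bool" where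
  "sobolev_H k f \<longleftrightarrow> L2 f \<and>
     (\<forall>vs. set vs \<subseteq> Basis \<and> length vs \<le> k \<longrightarrow> (\<exists>g. L2 g \<and> weak_deriv vs f g))"

definition wgrad :: "('a::euclidean_space \<Rightarrow> real) \<Rightarrow> 'a \<Rightarrow> 'a \<Rightarrow> real" where
  "wgrad f i = (SOME h. L2 h \<and> weak_deriv [i] f h)"

definition H1_dist :: "('a::euclidean_space \<Rightarrow> real) \<Rightarrow> ('a \<Rightarrow> real) \<Rightarrow> real" where
  "H1_dist f g = L2_dist f g + (\<Sum>i\<in>Basis. L2_dist (wgrad f i) (wgrad g i))"

definition nonlin :: "nat \<Rightarrow> (real \<Rightarrow> real) \<Rightarrow> real \<Rightarrow> real" where
  "nonlin n \<mu> v = \<bar>v\<bar> powr (1 + 2 / real n) * \<mu> \<bar>v\<bar>"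

definition lap_x :: "(real \<times> 'a::euclidean_space \<Rightarrow> real) \<Rightarrow> real \<times> 'a \<Rightarrow> real" where
  "lap_x \<phi> z = (\<Sum>i\<in>Basis. dder [(0, i), (0, i)] \<phi> z)"

text \<open>Global Sobolev solution u in C([0,oo), H^1 cap L^oo) of
  u_tt - Lap u + u_t = |u|^(1+2/n) mu(|u|),  u(0)=0, u_t(0)=g,
  in the distributional sense (test functions in C_c^oo([0,oo) x R^n)).\<close>
definition global_sobolev_solution ::
  "(real \<Rightarrow> real) \<Rightarrow> (real^'n \<Rightarrow> real) \<Rightarrow> (real \<Rightarrow> real^'n \<Rightarrow> real) \<Rightarrow> bool" where
  "global_sobolev_solution \<mu> g u \<longleftrightarrow>
     (\<forall>t\<ge>0. sobolev_H 1 (u t) \<and> Linf (u t)) \<and>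
     (\<forall>t0\<ge>0. \<forall>\<epsilon>>0. \<exists>\<delta>>0. \<forall>t\<ge>0. \<bar>t - t0\<bar> < \<delta> \<longrightarrow>
         H1_dist (u t) (u t0) < \<epsilon> \<and> (AE x in lborel. \<bar>u t x - u t0 x\<bar> \<le> \<epsilon>)) \<and>
     (AE x in lborel. u 0 x = 0) \<and>
     (\<forall>\<phi> :: real \<times> (real^'n) \<Rightarrow> real. test_fun \<phi> \<longrightarrow>
        (LINT t:{0..}|lborel. (LINT x|lborel.
            u t x * (dder [(1, 0), (1, 0)] \<phi> (t, x) - lap_x \<phi> (t, x) - dder [(1, 0)] \<phi> (t, x))))
        = (LINT t:{0..}|lborel. (LINT x|lborel. nonlin CARD('n) \<mu> (u t x) * \<phi> (t, x)))
          + (LINT x|lborel. g x * \<phi> (0, x)))"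

end

theory Submission
  imports Defs "HOL-Computational_Algebra.Polynomial"
begin

text \<open>
  Test the equation with cutoffs \<open>\<psi>\<^sub>R\<close> that are parabolically scaled, living on \<open>\<bar>t\<bar> \<le> R\<close>,
  \<open>\<bar>x\<bar>\<^sup>2 \<le> R\<close>. Let \<open>p = 1 + 2/n\<close>, \<open>h(s) = s\<^sup>p \<mu>(s)\<close> and let \<open>I(R)\<close> be the integral of
  \<open>h(\<bar>u\<bar>) \<psi>\<^sub>R\<close>. The adjoint operator maps \<open>\<psi>\<^sub>R\<close> to a function bounded by a multiple of
  \<open>\<psi>\<^sub>R\<close> to the power \<open>1/p\<close> over \<open>R\<close>, and supported where \<open>\<psi>\<close> at scale \<open>R/2\<close> vanishes. Jensen's
  inequality for \<open>h\<close> then bounds \<open>h(const (I(R) + c) / R\<^bsup>n/2\<^esup>)\<close> by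
  \<open>const (I(R) - I(R/2)) / R\<^bsup>1+n/2\<^esup>\<close>, where \<open>c > 0\<close> comes from the mean of \<open>g\<close>. For \<open>R = 2\<^sup>k\<close>
  and \<open>y\<^sub>k = I(2\<^sup>k) + c\<close> this reads
  \<open>\<mu>(d 2\<^bsup>-kn/2\<^esup>) \<le> const (y\<^sub>k - y\<^bsub>k-1\<^esub>) / y\<^sub>k\<^sup>p\<close>. The right-hand side is summable, since
  it is dominated by a telescoping sum, whereas summability of the left-hand side contradicts the
  divergence of the integral.

  A solution need not be jointly measurable in \<open>(t, x)\<close>, so Fubini's theorem is not available. Hence
  Jensen's inequality is replaced by the pointwise tangent line inequality, integrated first in \<open>x\<close>
  and then in \<open>t\<close>.
\<close>

section \<open>Smooth functions built from the flat exponential\<close>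

text \<open>The polynomial factor makes the family closed under differentiation, since
  differentiating exp(-1/s) brings down powers of 1/s. \<open>flat_exp 1\<close> is the classical
  smooth function that vanishes to infinite order at 0.\<close>

definition flat_exp :: "real poly \<Rightarrow> real \<Rightarrow> real" where
  "flat_exp P s = (if s > 0 then poly P (1 / s) * exp (- (1 / s)) else 0)"

text \<open>Chosen so that \<open>flat_exp (flat_deriv P)\<close> is the derivative of \<open>flat_exp P\<close>.\<close>
definition flat_deriv :: "real poly \<Rightarrow> real poly" where
  "flat_deriv P = [:0, 0, 1:] * (P - pderiv P)"

text \<open>Horner induction: an extra factor y costs half of the exponent, and the other half goes
  to the induction hypothesis. This is why \<open>\<epsilon>\<close> stays arbitrary in the
  induction.\<close>

lemma poly_le_exp:
  fixes P :: "real poly"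
  assumes "\<epsilon> > 0"
  shows "\<exists>C\<ge>0. \<forall>y\<ge>0. \<bar>poly P y\<bar> \<le> C * exp (\<epsilon> * y)"
  using assms
proof (induction P arbitrary: \<epsilon>)
  case 0
  then show ?case by (intro exI[of _ 0]) simp
next
  case (pCons a P)
  obtain C where C: "C \<ge> 0" "\<And>y. y \<ge> 0 \<Longrightarrow> \<bar>poly P y\<bar> \<le> C * exp (\<epsilon> / 2 * y)"
    using pCons.IH[of "\<epsilon> / 2"] pCons.prems by auto
  have "\<bar>poly (pCons a P) y\<bar> \<le> (\<bar>a\<bar> + 2 / \<epsilon> * C) * exp (\<epsilon> * y)" if y: "y \<ge> 0" for y
  proof -
    have "\<epsilon> / 2 * y \<le> exp (\<epsilon> / 2 * y)"
      using exp_ge_add_one_self[of "\<epsilon> / 2 * y"] by linarith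
    then have y': "y \<le> 2 / \<epsilon> * exp (\<epsilon> / 2 * y)"
      using pCons.prems by (simp add: field_simps)
    have "y * \<bar>poly P y\<bar> \<le> (2 / \<epsilon> * exp (\<epsilon> / 2 * y)) * (C * exp (\<epsilon> / 2 * y))"
      using y' C(2)[OF y] y by (intro mult_mono) auto
    also have "\<dots> = 2 / \<epsilon> * C * exp (\<epsilon> * y)"
      by (simp add: mult_exp_exp)
    finally have "y * \<bar>poly P y\<bar> \<le> 2 / \<epsilon> * C * exp (\<epsilon> * y)" .
    moreover have "\<bar>a\<bar> * 1 \<le> \<bar>a\<bar> * exp (\<epsilon> * y)"
      using y pCons.prems by (intro mult_left_mono) auto
    moreover have "\<bar>a + y * poly P y\<bar> \<le> \<bar>a\<bar> + y * \<bar>poly P y\<bar>"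
      using y abs_triangle_ineq[of a "y * poly P y"] by (simp add: abs_mult)
    ultimately show ?thesis by (simp add: distrib_right)
  qed
  moreover have "\<bar>a\<bar> + 2 / \<epsilon> * C \<ge> 0" using C(1) pCons.prems by simp
  ultimately show ?case by blast
qed

text \<open>With y = 1/s, the factor exp((1 - q) y) absorbs the polynomial and leaves exp(-q y).
  Through this bound the derivatives of the cutoff are controlled by a power of the cutoff itself;
  for q = 1 nothing would be left to absorb the polynomial.\<close>

lemma flat_exp_le_powr:
  assumes "q < 1"
  shows "\<exists>C\<ge>0. \<forall>s. \<bar>flat_exp P s\<bar> \<le> C * flat_exp 1 s powr q"
proof -
  obtain C where C: "C \<ge> 0" "\<And>y. y \<ge> 0 \<Longrightarrow> \<bar>poly P y\<bar> \<le> C * exp ((1 - q) * y)"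
    using poly_le_exp[of "1 - q" P] assms by auto
  have "\<bar>flat_exp P s\<bar> \<le> C * flat_exp 1 s powr q" for s
  proof (cases "s > 0")
    case True
    have "\<bar>flat_exp P s\<bar> \<le> C * exp ((1 - q) * (1 / s)) * exp (- (1 / s))"
      using True C(2)[of "1 / s"] by (simp add: flat_exp_def abs_mult)
    also have "\<dots> = C * exp (q * (- (1 / s)))"
      using True by (simp only: mult.assoc mult_exp_exp) (simp add: field_simps)
    finally show ?thesis
      using True by (simp add: flat_exp_def exp_powr_real mult.commute)
  qed (simp add: flat_exp_def)
  then show ?thesis using C(1) by blast
qed

lemma flat_exp_DERIV:
  "(flat_exp P has_real_derivative flat_exp (flat_deriv P) s) (at s)"
proof -
  consider "s > 0" | "s < 0" | "s = 0" by linarith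
  then show ?thesis
  proof cases
    case 1
    have "((\<lambda>s. poly P (1 / s) * exp (- (1 / s))) has_real_derivative
        flat_exp (flat_deriv P) s) (at s)"
      using 1 by (auto intro!: derivative_eq_intros DERIV_chain2[OF poly_DERIV]
          simp: flat_exp_def flat_deriv_def field_simps power2_eq_square)
    then show ?thesis
      by (rule has_field_derivative_transform_within_open[of _ _ _ "{0<..}"])
        (use 1 in \<open>auto simp: flat_exp_def\<close>)
  next
    case 2
    have "((\<lambda>s. 0) has_real_derivative flat_exp (flat_deriv P) s) (at s)"
      using 2 by (simp add: flat_exp_def)
    then show ?thesis
      by (rule has_field_derivative_transform_within_open[of _ _ _ "{..<0}"])
        (use 2 in \<open>auto simp: flat_exp_def\<close>)
  next
    case 3
    \<comment> \<open>Multiplying \<open>P\<close> by the square of the variable and taking q = 0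
      shows that \<open>flat_exp P s\<close> is O(s^2), so the difference quotient at 0 is
      O(|s|).\<close>
    obtain C where C: "C \<ge> 0" "\<And>s. \<bar>flat_exp ([:0, 0, 1:] * P) s\<bar> \<le> C * flat_exp 1 s powr 0"
      using flat_exp_le_powr[of 0] by auto
    have *: "\<bar>flat_exp P s / s\<bar> \<le> C * \<bar>s\<bar>" for s
    proof (cases "s > 0")
      case True
      then show ?thesis
        using C(2)[of s] by (simp add: flat_exp_def abs_mult field_simps power2_eq_square)
    qed (use C(1) in \<open>simp add: flat_exp_def mult_nonneg_nonpos\<close>)
    have "((\<lambda>s. flat_exp P s / s) \<longlongrightarrow> 0) (at 0)"
    proof (rule Lim_null_comparison)
      show "\<forall>\<^sub>F s in at 0. norm (flat_exp P s / s) \<le> C * \<bar>s\<bar>"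
        using * by simp
      show "((\<lambda>s. C * \<bar>s\<bar>) \<longlongrightarrow> 0) (at 0)"
        by (auto intro!: tendsto_eq_intros)
    qed
    then show ?thesis
      using 3 by (simp add: has_field_derivative_iff flat_exp_def)
  qed
qed

section \<open>A class of smooth functions and its derivatives\<close>

declare dder.simps(2) [simp del]

text \<open>This class is closed under directional derivatives, hence consists of smooth functions.\<close>
inductive smooth_term :: "('a::real_inner \<Rightarrow> real) \<Rightarrow> bool" where
  const: "smooth_term (\<lambda>x. c)"
| linear: "bounded_linear f \<Longrightarrow> smooth_term f"
| add: "smooth_term f \<Longrightarrow> smooth_term g \<Longrightarrow> smooth_term (\<lambda>x. f x + g x)"
| mult: "smooth_term f \<Longrightarrow> smooth_term g \<Longrightarrow> smooth_term (\<lambda>x. f x * g x)"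
| flat_exp: "smooth_term f \<Longrightarrow> smooth_term (\<lambda>x. flat_exp P (f x))"

lemma smooth_term_diff: "smooth_term f \<Longrightarrow> smooth_term g \<Longrightarrow> smooth_term (\<lambda>x. f x - g x)"
  using smooth_term.add[OF _ smooth_term.mult[OF smooth_term.const[of "-1"]], of f g] by simp

lemma smooth_term_sum: "(\<And>i. i \<in> A \<Longrightarrow> smooth_term (f i)) \<Longrightarrow> smooth_term (\<lambda>x. \<Sum>i\<in>A. f i x)"
  by (induction A rule: infinite_finite_induct) (auto intro: smooth_term.intros)

lemma smooth_term_compose_linear:
  "smooth_term f \<Longrightarrow> bounded_linear L \<Longrightarrow> smooth_term (\<lambda>x. f (L x))"
  by (induction rule: smooth_term.induct)
    (auto intro: smooth_term.intros bounded_linear_compose)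

text \<open>Each differentiation rule stays inside the class; the chain rule for
  \<open>flat_exp P\<close> merely replaces \<open>P\<close> by \<open>flat_deriv P\<close>. The
  direction is the first argument of \<open>D\<close>, so that \<open>D v\<close> is again a
  function to differentiate.\<close>

lemma smooth_term_has_derivative:
  "smooth_term f \<Longrightarrow> \<exists>D. (\<forall>x. (f has_derivative (\<lambda>v. D v x)) (at x)) \<and> (\<forall>v. smooth_term (D v))"
proof (induction rule: smooth_term.induct)
  case (const c)
  then show ?case by (intro exI[of _ "\<lambda>v x. 0"]) (auto intro: smooth_term.const)
next
  case (linear f)
  then show ?case
    by (intro exI[of _ "\<lambda>v x. f v"])
      (auto intro: smooth_term.const bounded_linear_imp_has_derivative)
next
  case (add f g)
  then obtain D E where "\<forall>x. (f has_derivative (\<lambda>v. D v x)) (at x)" "\<forall>v. smooth_term (D v)"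
    "\<forall>x. (g has_derivative (\<lambda>v. E v x)) (at x)" "\<forall>v. smooth_term (E v)" by blast
  then show ?case
    by (intro exI[of _ "\<lambda>v x. D v x + E v x"]) (auto intro!: smooth_term.add has_derivative_add)
next
  case (mult f g)
  then obtain D E where "\<forall>x. (f has_derivative (\<lambda>v. D v x)) (at x)" "\<forall>v. smooth_term (D v)"
    "\<forall>x. (g has_derivative (\<lambda>v. E v x)) (at x)" "\<forall>v. smooth_term (E v)" by blast
  then show ?case using mult.hyps
    by (intro exI[of _ "\<lambda>v x. f x * E v x + D v x * g x"])
      (auto intro!: smooth_term.add smooth_term.mult has_derivative_mult)
next
  case (flat_exp f P)
  then obtain D where D: "\<forall>x. (f has_derivative (\<lambda>v. D v x)) (at x)" "\<forall>v. smooth_term (D v)"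
    by blast
  have "((\<lambda>x. flat_exp P (f x)) has_derivative
      (\<lambda>v. flat_exp (flat_deriv P) (f x) * D v x)) (at x)" for x
    using has_derivative_compose[OF D(1)[rule_format]
        flat_exp_DERIV[of P "f x", unfolded has_field_derivative_def]] .
  then show ?case using D(2) flat_exp.hyps
    by (intro exI[of _ "\<lambda>v x. flat_exp (flat_deriv P) (f x) * D v x"])
      (auto intro!: smooth_term.mult smooth_term.flat_exp)
qed

lemma smooth_term_derivative:
  assumes "smooth_term f"
  shows "(f has_derivative (\<lambda>v. dder [v] f x)) (at x)" and "smooth_term (dder [v] f)"
proof -
  obtain D where D: "\<And>x. (f has_derivative (\<lambda>v. D v x)) (at x)" "\<And>v. smooth_term (D v)"
    using smooth_term_has_derivative[OF assms] by blast
  have "dder [v] f = D v" for v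
    by (simp add: dder.simps frechet_derivative_at[OF D(1), symmetric])
  then show "(f has_derivative (\<lambda>v. dder [v] f x)) (at x)" and "smooth_term (dder [v] f)"
    using D by auto
qed

section \<open>Calculus rules for iterated directional derivatives\<close>

lemma dder_Cons: "dder (v # vs) f = dder [v] (dder vs f)"
  by (simp add: dder.simps)

lemma smooth_term_dder: "smooth_term f \<Longrightarrow> smooth_term (dder vs f)"
proof (induction vs)
  case (Cons v vs)
  then show ?case unfolding dder_Cons[of v vs] by (intro smooth_term_derivative)
qed simp

lemma smooth_term_continuous: "smooth_term f \<Longrightarrow> continuous_on A f"
  using smooth_term_derivative(1)
  by (intro continuous_at_imp_continuous_on ballI has_derivative_continuous)

lemma smooth_term_imp_smooth_fun: "smooth_term f \<Longrightarrow> smooth_fun f"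
  unfolding smooth_fun_def
  using smooth_term_derivative(1)[OF smooth_term_dder] differentiableI by blast

lemma dder_eqI: "(f has_derivative f') (at x) \<Longrightarrow> dder [v] f x = f' v"
  by (simp add: dder.simps frechet_derivative_at[symmetric])

lemma dder_mult:
  assumes "smooth_term f" "smooth_term g"
  shows "dder [v] (\<lambda>x. f x * g x) x = f x * dder [v] g x + dder [v] f x * g x"
  by (rule dder_eqI has_derivative_mult smooth_term_derivative(1) assms)+

lemma dder_flat_exp:
  assumes "smooth_term f"
  shows "dder [v] (\<lambda>x. flat_exp P (f x)) x =
    flat_exp (flat_deriv P) (f x) * dder [v] f x"
  by (rule dder_eqI has_derivative_compose[OF smooth_term_derivative(1)[OF assms]
      flat_exp_DERIV[unfolded has_field_derivative_def]])+

lemma dder_compose_linear: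
  assumes "smooth_term f" "bounded_linear L"
  shows "dder [v] (\<lambda>x. f (L x)) x = dder [L v] f (L x)"
  by (rule dder_eqI has_derivative_compose[OF bounded_linear_imp_has_derivative[OF assms(2)]
      smooth_term_derivative(1)[OF assms(1)]])+

lemma dder_scaleR:
  assumes "smooth_term f"
  shows "dder [c *\<^sub>R v] f x = c * dder [v] f x"
  using linear_cmul[OF has_derivative_linear[OF smooth_term_derivative(1)[OF assms]], of c v]
  by simp

section \<open>Parabolically scaled cutoffs\<close>

lemma dder_const_diff:
  assumes "smooth_term f"
  shows "dder [v] (\<lambda>x. c - f x) = (\<lambda>x. 0 - dder [v] f x)"
  by (rule ext, rule dder_eqI)
    (intro has_derivative_diff has_derivative_const smooth_term_derivative(1) assms)

lemma dder2_flat_exp: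
  assumes "smooth_term f"
  shows "dder [v, v] (\<lambda>x. flat_exp P (f x)) x =
    flat_exp (flat_deriv P) (f x) * dder [v, v] f x +
    flat_exp (flat_deriv (flat_deriv P)) (f x)
      * (dder [v] f x)\<^sup>2"
proof -
  have "dder [v] (\<lambda>x. flat_exp P (f x)) =
      (\<lambda>x. flat_exp (flat_deriv P) (f x) * dder [v] f x)"
    using dder_flat_exp[OF assms] by (rule ext)
  then show ?thesis
    unfolding dder_Cons[of v "[v]"]
    by (simp only: dder_mult[OF smooth_term.flat_exp[OF assms] smooth_term_derivative(2)[OF assms]]
        dder_flat_exp[OF assms] power2_eq_square mult.assoc)
qed

text \<open>Both summands are multiplied by R^2 under t -> R t, x -> sqrt(R) x, and the gauge is a
  polynomial, hence smooth at the origin too.\<close>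

definition parabolic_gauge :: "real \<times> 'a::euclidean_space \<Rightarrow> real" where
  "parabolic_gauge z = (fst z)\<^sup>2 + (snd z \<bullet> snd z)\<^sup>2"

text \<open>Two nested flat exponentials give a function with a plateau and compact support, without any
  division: the inner one is constant for gauge at most \<open>1/2\<close>, the outer one vanishes for gauge at
  least \<open>1\<close>.\<close>
definition cutoff_arg :: "real \<times> 'a::euclidean_space \<Rightarrow> real" where
  "cutoff_arg z = flat_exp 1 (1 / 2) - flat_exp 1 (parabolic_gauge z - 1 / 2)"

definition cutoff :: "real \<times> 'a::euclidean_space \<Rightarrow> real" where
  "cutoff z = flat_exp 1 (cutoff_arg z)"

lemma smooth_term_parabolic_gauge: "smooth_term parabolic_gauge"
proof -
  have fst: "smooth_term (fst :: real \<times> 'a \<Rightarrow> real)"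
    by (intro smooth_term.linear bounded_linear_fst)
  have snd: "smooth_term (\<lambda>z :: real \<times> 'a. snd z \<bullet> i)" for i
    by (intro smooth_term.linear bounded_linear_compose[OF bounded_linear_inner_left]
        bounded_linear_snd)
  \<comment> \<open>Coordinates turn the inner product into products of linear forms, which the
    constructors of \<open>smooth_term\<close> cover.\<close>
  have "parabolic_gauge = (\<lambda>z :: real \<times> 'a. fst z * fst z +
      (\<Sum>i\<in>Basis. (snd z \<bullet> i) * (snd z \<bullet> i)) * (\<Sum>i\<in>Basis. (snd z \<bullet> i) * (snd z \<bullet> i)))"
    unfolding parabolic_gauge_def power2_eq_square euclidean_inner[symmetric] by simp
  moreover have "smooth_term \<dots>"
    by (intro smooth_term.add smooth_term.mult smooth_term_sum fst snd)
  ultimately show ?thesis by simp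
qed

lemma smooth_term_gauge_shift: "smooth_term (\<lambda>z. parabolic_gauge z - 1 / 2)"
  by (intro smooth_term_diff smooth_term_parabolic_gauge smooth_term.const)

lemma smooth_term_cutoff_arg: "smooth_term cutoff_arg"
  unfolding cutoff_arg_def[abs_def]
  by (intro smooth_term_diff smooth_term.flat_exp smooth_term_gauge_shift smooth_term.const)

lemma smooth_term_cutoff: "smooth_term cutoff"
  unfolding cutoff_def[abs_def] by (intro smooth_term.flat_exp smooth_term_cutoff_arg)

lemma flat_exp_1_mono: "s \<le> r \<Longrightarrow> flat_exp 1 s \<le> flat_exp 1 r"
  by (auto simp: flat_exp_def frac_le)

lemma flat_exp_1_bounds: "0 \<le> flat_exp 1 s" "flat_exp 1 s \<le> 1"
  by (auto simp: flat_exp_def)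

lemma cutoff_bounds: "0 \<le> cutoff z" "cutoff z \<le> 1"
  by (simp_all add: cutoff_def flat_exp_1_bounds)

lemma cutoff_antimono: "parabolic_gauge z \<le> parabolic_gauge w \<Longrightarrow> cutoff w \<le> cutoff z"
  unfolding cutoff_def cutoff_arg_def by (intro flat_exp_1_mono diff_left_mono) simp

lemma cutoff_arg_nonpos: "parabolic_gauge z \<ge> 1 \<Longrightarrow> cutoff_arg z \<le> 0"
  unfolding cutoff_arg_def using flat_exp_1_mono[of "1 / 2" "parabolic_gauge z - 1 / 2"] by simp

lemma cutoff_eq_0: "parabolic_gauge z \<ge> 1 \<Longrightarrow> cutoff z = 0"
  using cutoff_arg_nonpos[of z] by (simp add: cutoff_def flat_exp_def)

lemma cutoff_zero_pos: "cutoff 0 > 0"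
  by (simp add: cutoff_def cutoff_arg_def parabolic_gauge_def flat_exp_def)

lemma parabolic_gauge_less_1:
  assumes "parabolic_gauge z < 1"
  shows "\<bar>fst z\<bar> < 1" "norm (snd z) < 1"
proof -
  have "(fst z)\<^sup>2 < 1" "(snd z \<bullet> snd z)\<^sup>2 < 1"
    using assms unfolding parabolic_gauge_def by (smt (verit) zero_le_power2)+
  then have "\<bar>fst z\<bar> < 1" "\<bar>snd z \<bullet> snd z\<bar> < 1"
    by (auto simp: abs_square_less_1)
  then show "\<bar>fst z\<bar> < 1" "norm (snd z) < 1"
    by (auto simp: dot_square_norm abs_square_less_1)
qed

text \<open>Three regions: on the plateau the derivatives of \<open>cutoff_arg\<close> vanish; for
  gauge at least 1 the outer flat exponentials vanish; in between, the derivatives of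
  \<open>cutoff_arg\<close> are bounded and \<open>flat_exp_le_powr\<close> bounds the outer factors
  by the power q of the cutoff.\<close>

lemma cutoff_dder_bound:
  fixes v :: "real \<times> 'a::euclidean_space"
  assumes "q < 1"
  shows "\<exists>C\<ge>0. \<forall>z.
    \<bar>dder [v] cutoff z\<bar> \<le> C * (if parabolic_gauge z \<le> 1 / 2 then 0 else cutoff z powr q) \<and>
    \<bar>dder [v, v] cutoff z\<bar> \<le> C * (if parabolic_gauge z \<le> 1 / 2 then 0 else cutoff z powr q)"
proof -
  let ?f = "cutoff_arg :: real \<times> 'a \<Rightarrow> real"
  define P1 :: "real poly" where "P1 = flat_deriv 1"
  define P2 :: "real poly" where "P2 = flat_deriv P1"
  have cutoff_eq: "cutoff = (\<lambda>z. flat_exp 1 (?f z))"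
    by (rule ext) (simp add: cutoff_def)
  have d1: "dder [v] cutoff z = flat_exp P1 (?f z) * dder [v] ?f z"
    and d2: "dder [v, v] cutoff z =
      flat_exp P1 (?f z) * dder [v, v] ?f z + flat_exp P2 (?f z) * (dder [v] ?f z)\<^sup>2" for z
    unfolding cutoff_eq P2_def P1_def
    by (rule dder_flat_exp dder2_flat_exp smooth_term_cutoff_arg)+
  have arg1: "dder [v] ?f = (\<lambda>z. 0 - dder [v] (\<lambda>z. flat_exp 1 (parabolic_gauge z - 1 / 2)) z)"
    unfolding cutoff_arg_def[abs_def]
    by (intro dder_const_diff smooth_term.flat_exp smooth_term_gauge_shift)
  have arg2: "dder [v, v] ?f =
      (\<lambda>z. 0 - dder [v, v] (\<lambda>z. flat_exp 1 (parabolic_gauge z - 1 / 2)) z)"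
    unfolding dder_Cons[of v "[v]"] arg1
    by (intro dder_const_diff smooth_term_derivative(2) smooth_term.flat_exp smooth_term_gauge_shift)
  \<comment> \<open>On the plateau the inner flat exponentials are evaluated at nonpositive
    arguments, where they are 0; this includes gauge exactly 1/2.\<close>
  have flat: "dder [v] ?f z = 0" "dder [v, v] ?f z = 0" if "parabolic_gauge z \<le> 1 / 2" for z
    using that unfolding arg1 arg2 dder_flat_exp[OF smooth_term_gauge_shift]
      dder2_flat_exp[OF smooth_term_gauge_shift]
    by (simp_all add: flat_exp_def)
  obtain C1 where C1: "C1 \<ge> 0" "\<And>s. \<bar>flat_exp P1 s\<bar> \<le> C1 * flat_exp 1 s powr q"
    using flat_exp_le_powr[OF assms] by blast
  obtain C2 where C2: "C2 \<ge> 0" "\<And>s. \<bar>flat_exp P2 s\<bar> \<le> C2 * flat_exp 1 s powr q"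
    using flat_exp_le_powr[OF assms] by blast
  \<comment> \<open>The compact set contains every point of gauge below 1, the only region where a
    bound on the derivatives of \<open>cutoff_arg\<close> is required.\<close>
  have bdd: "\<exists>M\<ge>0. \<forall>z\<in>{-1..1} \<times> cball 0 1. \<bar>F z\<bar> \<le> M" if "smooth_term F"
    for F :: "real \<times> 'a \<Rightarrow> real"
  proof -
    have "compact (F ` ({-1..1} \<times> cball 0 1))"
      by (intro compact_continuous_image smooth_term_continuous that compact_Times) auto
    then obtain M where "\<forall>y\<in>F ` ({-1..1} \<times> cball 0 1). norm y \<le> M"
      using compact_imp_bounded bounded_iff by metis
    then show ?thesis by (intro exI[of _ "max M 0"]) (auto simp: max.coboundedI1)
  qed
  obtain M1 where M1: "M1 \<ge> 0" "\<And>z. z \<in> {-1..1} \<times> cball 0 1 \<Longrightarrow> \<bar>dder [v] ?f z\<bar> \<le> M1"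
    using bdd[OF smooth_term_dder[OF smooth_term_cutoff_arg]] by blast
  obtain M2 where M2: "M2 \<ge> 0" "\<And>z. z \<in> {-1..1} \<times> cball 0 1 \<Longrightarrow> \<bar>dder [v, v] ?f z\<bar> \<le> M2"
    using bdd[OF smooth_term_dder[OF smooth_term_cutoff_arg]] by blast
  define C where "C = C1 * M1 + C1 * M2 + C2 * M1\<^sup>2"
  have "C \<ge> 0" using C1 C2 M1 M2 by (simp add: C_def)
  moreover have "\<bar>dder [v] cutoff z\<bar> \<le> C * (if parabolic_gauge z \<le> 1 / 2 then 0 else cutoff z powr q) \<and>
    \<bar>dder [v, v] cutoff z\<bar> \<le> C * (if parabolic_gauge z \<le> 1 / 2 then 0 else cutoff z powr q)" for z
  proof -
    consider "parabolic_gauge z \<le> 1 / 2" | "parabolic_gauge z \<ge> 1"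
      | "parabolic_gauge z > 1 / 2" "parabolic_gauge z < 1" by linarith
    then show ?thesis
    proof cases
      case 1
      then show ?thesis unfolding d1 d2 by (simp add: flat)
    next
      case 2
      then have "flat_exp P (?f z) = 0" for P
        using cutoff_arg_nonpos[of z] by (simp add: flat_exp_def)
      then show ?thesis unfolding d1 d2 using 2 by (simp add: cutoff_eq_0)
    next
      case 3
      have z: "z \<in> {-1..1} \<times> cball 0 1"
        using parabolic_gauge_less_1[OF 3(2)] by (cases z) (auto simp: abs_le_iff less_imp_le)
      have a: "\<bar>flat_exp P1 (?f z) * dder [v] ?f z\<bar> \<le> (C1 * cutoff z powr q) * M1"
        unfolding abs_mult cutoff_def
        using C1 M1(2)[OF z] by (intro mult_mono) auto
      have b: "\<bar>flat_exp P1 (?f z) * dder [v, v] ?f z\<bar> \<le> (C1 * cutoff z powr q) * M2"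
        unfolding abs_mult cutoff_def
        using C1 M2(2)[OF z] by (intro mult_mono) auto
      have c: "\<bar>flat_exp P2 (?f z) * (dder [v] ?f z)\<^sup>2\<bar> \<le> (C2 * cutoff z powr q) * M1\<^sup>2"
        unfolding abs_mult cutoff_def power_abs
        using C2 M1(2)[OF z] by (intro mult_mono power_mono) auto
      have nn: "(C1 * cutoff z powr q) * M1 \<ge> 0" "(C1 * cutoff z powr q) * M2 \<ge> 0"
        "(C2 * cutoff z powr q) * M1\<^sup>2 \<ge> 0"
        using C1 C2 M1 M2 by auto
      have "C * cutoff z powr q = (C1 * cutoff z powr q) * M1 + (C1 * cutoff z powr q) * M2
          + (C2 * cutoff z powr q) * M1\<^sup>2"
        by (simp add: C_def algebra_simps)
      then show ?thesis
        unfolding d1 d2 using a b c nn 3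
          abs_triangle_ineq[of "flat_exp P1 (?f z) * dder [v, v] ?f z"
            "flat_exp P2 (?f z) * (dder [v] ?f z)\<^sup>2"]
        by auto
    qed
  qed
  ultimately show ?thesis by blast
qed

section \<open>Diffusive rescaling and the adjoint operator\<close>

definition rescale :: "real \<Rightarrow> real \<times> 'a::euclidean_space \<Rightarrow> real \<times> 'a" where
  "rescale R z = (fst z / R, snd z /\<^sub>R sqrt R)"

lemma bounded_linear_rescale: "bounded_linear (rescale R)"
  unfolding rescale_def[abs_def]
  by (rule bounded_linear_Pair[OF bounded_linear_compose[OF bounded_linear_divide bounded_linear_fst]
        bounded_linear_compose[OF bounded_linear_scaleR_right bounded_linear_snd]])

definition scaled_cutoff :: "real \<Rightarrow> real \<times> 'a::euclidean_space \<Rightarrow> real" where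
  "scaled_cutoff R z = cutoff (rescale R z)"

lemma smooth_term_scaled_cutoff: "smooth_term (scaled_cutoff R)"
  unfolding scaled_cutoff_def[abs_def]
  by (rule smooth_term_compose_linear[OF smooth_term_cutoff bounded_linear_rescale])

lemma scaled_cutoff_bounds: "0 \<le> scaled_cutoff R z" "scaled_cutoff R z \<le> 1"
  by (simp_all add: scaled_cutoff_def cutoff_bounds)

lemma parabolic_gauge_rescale:
  assumes "R > 0"
  shows "parabolic_gauge (rescale R z) = parabolic_gauge z / R\<^sup>2"
proof -
  have "snd (rescale R z) \<bullet> snd (rescale R z) = snd z \<bullet> snd z / R"
    using assms by (simp add: rescale_def inverse_eq_divide)
  then show ?thesis
    by (simp add: parabolic_gauge_def rescale_def power_divide add_divide_distrib)
qed

lemma parabolic_gauge_nonneg: "parabolic_gauge z \<ge> 0"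
  by (simp add: parabolic_gauge_def)

lemma scaled_cutoff_mono: "0 < R \<Longrightarrow> R \<le> S \<Longrightarrow> scaled_cutoff R z \<le> scaled_cutoff S z"
  unfolding scaled_cutoff_def
  by (intro cutoff_antimono, subst (1 2) parabolic_gauge_rescale)
    (auto intro!: divide_left_mono power_mono simp: parabolic_gauge_nonneg)

text \<open>Halving R multiplies the gauge by 4, which takes it from above 1/2 to above 2, outside
  the support. Hence the region where the adjoint acts contributes nothing at scale R/2, and only a
  difference of two masses will appear.\<close>

lemma scaled_cutoff_half:
  assumes "R > 0" "parabolic_gauge (rescale R z) > 1 / 2"
  shows "scaled_cutoff (R / 2) z = 0"
proof -
  have "parabolic_gauge (rescale (R / 2) z) = 4 * parabolic_gauge (rescale R z)"
    using assms(1) by (simp add: parabolic_gauge_rescale power_divide)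
  then show ?thesis
    unfolding scaled_cutoff_def using assms(2) by (intro cutoff_eq_0) simp
qed

lemma scaled_cutoff_support:
  assumes "R > 0" "scaled_cutoff R (t, x) \<noteq> 0"
  shows "\<bar>t\<bar> < R" "norm x < sqrt R"
proof -
  have "parabolic_gauge (rescale R (t, x)) < 1"
    using assms cutoff_eq_0[of "rescale R (t, x)"] unfolding scaled_cutoff_def by force
  from parabolic_gauge_less_1[OF this] show "\<bar>t\<bar> < R" "norm x < sqrt R"
    using assms(1) by (simp_all add: rescale_def inverse_eq_divide)
qed

lemma test_fun_scaled_cutoff:
  assumes "R > 0"
  shows "test_fun (scaled_cutoff R)"
proof -
  have "{z :: real \<times> 'a. scaled_cutoff R z \<noteq> 0} \<subseteq> cball 0 R \<times> cball 0 (sqrt R)"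
  proof
    fix z :: "real \<times> 'a"
    assume "z \<in> {z. scaled_cutoff R z \<noteq> 0}"
    then have "scaled_cutoff R (fst z, snd z) \<noteq> 0" by simp
    from scaled_cutoff_support[OF assms this]
    show "z \<in> cball 0 R \<times> cball 0 (sqrt R)"
      by (simp add: mem_Times_iff less_imp_le)
  qed
  then have "bounded {z :: real \<times> 'a. scaled_cutoff R z \<noteq> 0}"
    by (rule bounded_subset[rotated]) (intro bounded_Times bounded_cball)
  then show ?thesis
    unfolding test_fun_def
    using smooth_term_imp_smooth_fun[OF smooth_term_scaled_cutoff] by blast
qed

text \<open>Formal adjoint of the damped wave operator: integration by parts flips the sign of the
  damping term only.\<close>

definition wave_adjoint :: "(real \<times> 'a::euclidean_space \<Rightarrow> real) \<Rightarrow> real \<times> 'a \<Rightarrow> real" where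
  "wave_adjoint \<phi> z = dder [(1, 0), (1, 0)] \<phi> z - lap_x \<phi> z - dder [(1, 0)] \<phi> z"

lemma continuous_wave_adjoint: "smooth_term \<phi> \<Longrightarrow> continuous_on A (wave_adjoint \<phi>)"
  unfolding wave_adjoint_def[abs_def] lap_x_def[abs_def]
  by (intro continuous_intros smooth_term_continuous smooth_term_dder)

lemma dder_scaled_cutoff:
  assumes "rescale R v = c *\<^sub>R w"
  shows "dder [v] (scaled_cutoff R) z = c * dder [w] cutoff (rescale R z)"
    and "dder [v, v] (scaled_cutoff R) z = c\<^sup>2 * dder [w, w] cutoff (rescale R z)"
proof -
  have 1: "dder [v] (scaled_cutoff R) = (\<lambda>z. c * dder [w] cutoff (rescale R z))"
    unfolding scaled_cutoff_def[abs_def]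
      dder_compose_linear[OF smooth_term_cutoff bounded_linear_rescale, abs_def]
      assms dder_scaleR[OF smooth_term_cutoff] ..
  then show "dder [v] (scaled_cutoff R) z = c * dder [w] cutoff (rescale R z)" by simp
  have s: "smooth_term (\<lambda>z. c * dder [w] cutoff z)"
    by (intro smooth_term.mult smooth_term.const smooth_term_dder smooth_term_cutoff)
  have "dder [v, v] (scaled_cutoff R) z = c * dder [w] (\<lambda>z. c * dder [w] cutoff z) (rescale R z)"
    unfolding dder_Cons[of v "[v]"] 1 dder_compose_linear[OF s bounded_linear_rescale] assms
      dder_scaleR[OF s] ..
  also have "dder [w] (\<lambda>z. c * dder [w] cutoff z) (rescale R z) =
      c * dder [w, w] cutoff (rescale R z)"
    unfolding dder_Cons[of w "[w]"]
    by (rule dder_eqI[OF has_derivative_mult_right[OF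
          smooth_term_derivative(1)[OF smooth_term_dder[OF smooth_term_cutoff]]]])
  finally show "dder [v, v] (scaled_cutoff R) z = c\<^sup>2 * dder [w, w] cutoff (rescale R z)"
    by (simp add: power2_eq_square)
qed

text \<open>The damping term scales like 1/R, the Laplacian like (1/sqrt R)^2 = 1/R, and the second
  time derivative like 1/R^2, which is at most 1/R because R is at least 1.\<close>

lemma wave_adjoint_scaled_cutoff_bound:
  assumes "q < 1"
  shows "\<exists>C>0. \<forall>R\<ge>1. \<forall>z :: real \<times> 'a::euclidean_space. \<bar>wave_adjoint (scaled_cutoff R) z\<bar> \<le>
    C / R * (if parabolic_gauge (rescale R z) \<le> 1 / 2 then 0 else scaled_cutoff R z powr q)"
proof -
  obtain C :: "real \<times> 'a \<Rightarrow> real" where C: "\<And>v. C v \<ge> 0"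
    "\<And>v z. \<bar>dder [v] cutoff z\<bar> \<le>
      C v * (if parabolic_gauge z \<le> 1 / 2 then 0 else cutoff z powr q)"
    "\<And>v z. \<bar>dder [v, v] cutoff z\<bar> \<le>
      C v * (if parabolic_gauge z \<le> 1 / 2 then 0 else cutoff z powr q)"
  proof -
    from choice[OF allI[OF cutoff_dder_bound[OF assms]]] obtain C :: "real \<times> 'a \<Rightarrow> real" where
      *: "\<forall>v. C v \<ge> 0 \<and> (\<forall>z.
        \<bar>dder [v] cutoff z\<bar> \<le> C v * (if parabolic_gauge z \<le> 1 / 2 then 0 else cutoff z powr q) \<and>
        \<bar>dder [v, v] cutoff z\<bar> \<le> C v * (if parabolic_gauge z \<le> 1 / 2 then 0 else cutoff z powr q))" ..
    show thesis
      by (rule that[of C]; use * in blast)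
  qed
  \<comment> \<open>\<open>C (1, 0)\<close> is counted once for the first and once for the second
    time derivative. The bound is stated with \<open>B + 1\<close> because the constant must be
    positive.\<close>
  define B :: real where "B = 2 * C (1, 0) + (\<Sum>i\<in>Basis. C (0, i))"
  have "\<bar>wave_adjoint (scaled_cutoff R) z\<bar> \<le> (B + 1) / R *
      (if parabolic_gauge (rescale R z) \<le> 1 / 2 then 0 else scaled_cutoff R z powr q)"
    if R: "R \<ge> 1" for R and z :: "real \<times> 'a"
  proof -
    define Q where
      "Q = (if parabolic_gauge (rescale R z) \<le> 1 / 2 then 0 else scaled_cutoff R z powr q)"
    have Q: "Q \<ge> 0" by (simp add: Q_def)
    have e0: "rescale R (1, 0) = (1 / R) *\<^sub>R (1, 0 :: 'a)"
      by (simp add: rescale_def)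
    have ei: "rescale R (0, i) = (1 / sqrt R) *\<^sub>R (0, i :: 'a)" for i
      by (simp add: rescale_def inverse_eq_divide)
    have R2: "1 / R\<^sup>2 \<le> 1 / R" using R by (simp add: frac_le power2_eq_square)
    have b: "\<bar>dder [v] cutoff (rescale R z)\<bar> \<le> C v * Q"
      "\<bar>dder [v, v] cutoff (rescale R z)\<bar> \<le> C v * Q" for v
      using C(2,3)[of v "rescale R z"] unfolding Q_def scaled_cutoff_def by blast+
    have t1: "\<bar>dder [(1, 0)] (scaled_cutoff R) z\<bar> \<le> 1 / R * (C (1, 0) * Q)"
      unfolding dder_scaled_cutoff(1)[OF e0] abs_mult
      using b(1)[of "(1, 0)"] R by (intro mult_mono) auto
    have "\<bar>dder [(1, 0), (1, 0)] (scaled_cutoff R) z\<bar> \<le> 1 / R\<^sup>2 * (C (1, 0) * Q)"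
      unfolding dder_scaled_cutoff(2)[OF e0] abs_mult
      using b(2)[of "(1, 0)"] R by (intro mult_mono) (auto simp: power_divide)
    also have "\<dots> \<le> 1 / R * (C (1, 0) * Q)"
      using R2 C(1) Q by (intro mult_right_mono) auto
    finally have t2: "\<bar>dder [(1, 0), (1, 0)] (scaled_cutoff R) z\<bar> \<le> 1 / R * (C (1, 0) * Q)" .
    have "\<bar>lap_x (scaled_cutoff R) z\<bar> \<le> (\<Sum>i\<in>Basis. 1 / R * (C (0, i) * Q))"
      unfolding lap_x_def
    proof (rule order_trans[OF sum_abs sum_mono])
      fix i :: 'a
      show "\<bar>dder [(0, i), (0, i)] (scaled_cutoff R) z\<bar> \<le> 1 / R * (C (0, i) * Q)"
        unfolding dder_scaled_cutoff(2)[OF ei] abs_mult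
        using b(2)[of "(0, i)"] R by (intro mult_mono) (auto simp: power_divide)
    qed
    also have "\<dots> = 1 / R * ((\<Sum>i\<in>Basis. C (0, i)) * Q)"
      by (simp add: sum_distrib_left sum_distrib_right)
    finally have t3: "\<bar>lap_x (scaled_cutoff R) z\<bar> \<le> 1 / R * ((\<Sum>i\<in>Basis. C (0, i)) * Q)" .
    have abs3: "\<bar>a - b - c\<bar> \<le> A + D + E" if "\<bar>a\<bar> \<le> A" "\<bar>b\<bar> \<le> D" "\<bar>c\<bar> \<le> E"
      for a b c A D E :: real
      using that by linarith
    have "\<bar>wave_adjoint (scaled_cutoff R) z\<bar> \<le> 1 / R * (C (1, 0) * Q) + 1 / R * (C (1, 0) * Q)
        + 1 / R * ((\<Sum>i\<in>Basis. C (0, i)) * Q)"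
      unfolding wave_adjoint_def using abs3[OF t2 t3 t1] by (simp only: add_ac)
    also have "\<dots> = B / R * Q"
      by (simp add: B_def add_divide_distrib distrib_right)
    also have "\<dots> \<le> (B + 1) / R * Q"
      using R Q by (intro mult_right_mono divide_right_mono) auto
    finally show ?thesis unfolding Q_def .
  qed
  moreover have "B + 1 > 0"
    unfolding B_def using C(1) by (simp add: add_nonneg_pos sum_nonneg)
  ultimately show ?thesis by blast
qed

section \<open>Integrals over time slices\<close>

lemma set_integrable_continuous_vanishing:
  fixes F :: "real \<Rightarrow> real"
  assumes "continuous_on {0..} F" and "\<And>t. t > R \<Longrightarrow> F t = 0"
  shows "set_integrable lborel {0..} F"
proof -
  have "set_integrable lborel {0..R} F"
    by (intro borel_integrable_atLeastAtMost' continuous_on_subset[OF assms(1)]) auto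
  moreover have "(\<lambda>t. indicator {0..R} t *\<^sub>R F t) = (\<lambda>t. indicator {0..} t *\<^sub>R F t)"
    using assms(2) by (force simp: indicator_def)
  ultimately show ?thesis by (simp add: set_integrable_def)
qed

text \<open>Substitute for joint measurability: continuity of u in time with respect to the
  essential supremum makes the integral over x a continuous function of t, so the outer integral
  makes sense. It is applied with \<open>G\<close> the identity or the nonlinearity, and
  \<open>W\<close> the adjoint of the cutoff or the cutoff itself.\<close>

lemma
  fixes u :: "real \<Rightarrow> 'a::euclidean_space \<Rightarrow> real" and G :: "real \<Rightarrow> real"
    and W :: "real \<times> 'a \<Rightarrow> real"
  assumes Linf: "\<And>t. t \<ge> 0 \<Longrightarrow> Linf (u t)"
    and cont: "\<And>t0 \<epsilon>. t0 \<ge> 0 \<Longrightarrow> \<epsilon> > 0 \<Longrightarrow>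
      \<exists>\<delta>>0. \<forall>t\<ge>0. \<bar>t - t0\<bar> < \<delta> \<longrightarrow> (AE x in lborel. \<bar>u t x - u t0 x\<bar> \<le> \<epsilon>)"
    and G: "continuous_on UNIV G" and W: "continuous_on UNIV W"
    and supp: "\<And>t x. norm x > r \<Longrightarrow> W (t, x) = 0"
  shows integrable_slice: "t \<ge> 0 \<Longrightarrow> integrable lborel (\<lambda>x. G (u t x) * W (t, x))"
    and continuous_on_slice_integral:
      "continuous_on {0..} (\<lambda>t. \<integral>x. G (u t x) * W (t, x) \<partial>lborel)"
proof -
  have G_meas: "G \<in> borel_measurable borel"
    using G by (rule borel_measurable_continuous_onI)
  have W_meas: "(\<lambda>x. W (t, x)) \<in> borel_measurable lborel" for t
    unfolding measurable_lborel2
    by (intro borel_measurable_continuous_onI continuous_on_compose2[OF W] continuous_intros) auto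
  have meas: "(\<lambda>x. G (u t x) * W (t, x)) \<in> borel_measurable lborel" if "t \<ge> 0" for t
    using Linf[OF that] W_meas[of t] G_meas unfolding Linf_def
    by (intro borel_measurable_times measurable_compose[OF _ G_meas]) auto
  \<comment> \<open>Compactness bounds \<open>G\<close> and \<open>W\<close> for bounded values and
    times; the resulting multiple of a ball indicator serves both for integrability and as
    dominating function.\<close>
  have bound: "\<exists>B. \<forall>t x v. \<bar>t\<bar> \<le> T \<longrightarrow> \<bar>v\<bar> \<le> C \<longrightarrow>
      \<bar>G v * W (t, x)\<bar> \<le> B * indicator (cball 0 r) x" for T C :: real
  proof -
    have "compact (G ` {-C..C})"
      by (intro compact_continuous_image continuous_on_subset[OF G]) auto
    then obtain B1 where B1: "\<forall>y\<in>G ` {-C..C}. norm y \<le> B1"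
      using compact_imp_bounded bounded_iff by metis
    have "compact (W ` ({-T..T} \<times> cball 0 r))"
      by (intro compact_continuous_image continuous_on_subset[OF W] compact_Times) auto
    then obtain B2 where B2: "\<forall>y\<in>W ` ({-T..T} \<times> cball 0 r). norm y \<le> B2"
      using compact_imp_bounded bounded_iff by metis
    have "\<bar>G v * W (t, x)\<bar> \<le> B1 * B2 * indicator (cball 0 r) x"
      if "\<bar>t\<bar> \<le> T" "\<bar>v\<bar> \<le> C" for t x v
    proof (cases "x \<in> cball 0 r")
      case True
      have "\<bar>G v\<bar> \<le> B1" "\<bar>W (t, x)\<bar> \<le> B2"
        using B1 B2 that True by (auto simp: abs_le_iff)
      then have "\<bar>G v\<bar> * \<bar>W (t, x)\<bar> \<le> B1 * B2"
        by (intro mult_mono) (auto intro: order_trans[OF abs_ge_zero])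
      then show ?thesis using True by (simp add: abs_mult)
    next
      case False
      then show ?thesis using supp[of x t] by simp
    qed
    then show ?thesis by blast
  qed
  have ball_int: "integrable lborel (\<lambda>x::'a. B * indicator (cball 0 r) x)" for B :: real
    by (intro integrable_mult_right integrable_real_indicator)
      (auto intro: emeasure_bounded_finite[simplified])
  show "integrable lborel (\<lambda>x. G (u t x) * W (t, x))" if t: "t \<ge> 0" for t
  proof -
    obtain C where C: "AE x in lborel. \<bar>u t x\<bar> \<le> C"
      using Linf[OF t] unfolding Linf_def by blast
    obtain B where B: "\<forall>s x v. \<bar>s\<bar> \<le> \<bar>t\<bar> \<longrightarrow> \<bar>v\<bar> \<le> C \<longrightarrow>
        \<bar>G v * W (s, x)\<bar> \<le> B * indicator (cball 0 r) x"
      using bound by blast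
    show ?thesis
    proof (rule Bochner_Integration.integrable_bound[OF ball_int[of B] meas[OF t]])
      show "AE x in lborel. norm (G (u t x) * W (t, x)) \<le> norm (B * indicator (cball 0 r) x)"
        using C
      proof eventually_elim
        case (elim x)
        then have "\<bar>G (u t x) * W (t, x)\<bar> \<le> B * indicator (cball 0 r) x"
          using B by blast
        then show ?case by simp
      qed
    qed
  qed
  show "continuous_on {0..} (\<lambda>t. \<integral>x. G (u t x) * W (t, x) \<partial>lborel)"
  proof (rule continuous_on_sequentiallyI)
    fix \<tau> :: "nat \<Rightarrow> real" and a
    assume \<tau>0: "\<forall>n. \<tau> n \<in> {0..}" and a: "a \<in> {0..}" and lim: "\<tau> \<longlonglongrightarrow> a"
    have near: "\<exists>N. \<forall>n\<ge>N. AE x in lborel. \<bar>u (\<tau> n) x - u a x\<bar> \<le> \<epsilon>" if "\<epsilon> > 0" for \<epsilon>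
    proof -
      have "a \<ge> 0" using a by simp
      from cont[OF this that] obtain \<delta> where \<delta>: "\<delta> > 0"
        "\<forall>t\<ge>0. \<bar>t - a\<bar> < \<delta> \<longrightarrow> (AE x in lborel. \<bar>u t x - u a x\<bar> \<le> \<epsilon>)"
        by blast
      obtain N where N: "\<forall>n\<ge>N. norm (\<tau> n - a) < \<delta>"
        using LIMSEQ_D[OF lim \<delta>(1)] by blast
      have "AE x in lborel. \<bar>u (\<tau> n) x - u a x\<bar> \<le> \<epsilon>" if "n \<ge> N" for n
        using \<delta>(2)[rule_format, of "\<tau> n"] \<tau>0 N that by simp
      then show ?thesis by blast
    qed
    obtain N where N: "\<And>n. n \<ge> N \<Longrightarrow> AE x in lborel. \<bar>u (\<tau> n) x - u a x\<bar> \<le> 1"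
      using near[of 1] by auto
    have "\<forall>j. \<exists>N. \<forall>n\<ge>N. AE x in lborel. \<bar>u (\<tau> n) x - u a x\<bar> \<le> 1 / real (Suc j)"
      by (intro allI near) simp
    then obtain M where M: "\<And>j n. n \<ge> M j \<Longrightarrow>
        AE x in lborel. \<bar>u (\<tau> n) x - u a x\<bar> \<le> 1 / real (Suc j)"
      by metis
    \<comment> \<open>The exceptional null sets are indexed by j and n, so their union is null, and
      off it the sequence converges pointwise.\<close>
    have "AE x in lborel. \<forall>j n. M j \<le> n \<longrightarrow> \<bar>u (\<tau> n) x - u a x\<bar> \<le> 1 / real (Suc j)"
      unfolding AE_all_countable using M by (auto intro: AE_I2)
    then have conv: "AE x in lborel. (\<lambda>n. u (\<tau> n) x) \<longlonglongrightarrow> u a x"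
    proof eventually_elim
      case (elim x)
      show ?case
      proof (rule LIMSEQ_I)
        fix e :: real assume "e > 0"
        then obtain j where j: "1 / real (Suc j) < e"
          using reals_Archimedean[of e] by (auto simp: inverse_eq_divide)
        then show "\<exists>no. \<forall>n\<ge>no. norm (u (\<tau> n) x - u a x) < e"
          using elim by (intro exI[of _ "M j"]) (auto intro: le_less_trans)
      qed
    qed
    obtain T where T: "\<And>n. \<bar>\<tau> n\<bar> \<le> T"
      using convergent_imp_Bseq[OF convergentI[OF lim]] unfolding Bseq_def by auto
    obtain C where C: "AE x in lborel. \<bar>u a x\<bar> \<le> C"
      using Linf[of a] a unfolding Linf_def by auto
    obtain B where B: "\<forall>s x v. \<bar>s\<bar> \<le> T \<longrightarrow> \<bar>v\<bar> \<le> C + 1 \<longrightarrow>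
        \<bar>G v * W (s, x)\<bar> \<le> B * indicator (cball 0 r) x"
      using bound by blast
    \<comment> \<open>From index \<open>N\<close> on, u is almost everywhere bounded by
      \<open>C + 1\<close>; the shift makes domination hold for every term.\<close>
    have "(\<lambda>n. \<integral>x. G (u (\<tau> (n + N)) x) * W (\<tau> (n + N), x) \<partial>lborel)
        \<longlonglongrightarrow> (\<integral>x. G (u a x) * W (a, x) \<partial>lborel)"
    proof (rule integral_dominated_convergence[where w = "\<lambda>x::'a. B * indicator (cball 0 r) x"])
      show "(\<lambda>x. G (u a x) * W (a, x)) \<in> borel_measurable lborel"
        using meas a by simp
      show "(\<lambda>x. G (u (\<tau> (n + N)) x) * W (\<tau> (n + N), x)) \<in> borel_measurable lborel" for n
        using meas \<tau>0 by simp
      show "integrable lborel (\<lambda>x::'a. B * indicator (cball 0 r) x)"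
        by (rule ball_int)
      show "AE x in lborel. (\<lambda>n. G (u (\<tau> (n + N)) x) * W (\<tau> (n + N), x))
          \<longlonglongrightarrow> G (u a x) * W (a, x)"
        using conv
      proof eventually_elim
        case (elim x)
        have "(\<lambda>n. G (u (\<tau> n) x) * W (\<tau> n, x)) \<longlonglongrightarrow> G (u a x) * W (a, x)"
          using continuous_on_tendsto_compose[OF G elim]
            continuous_on_tendsto_compose[OF W tendsto_Pair[OF lim tendsto_const]]
          by (intro tendsto_mult) auto
        then show ?case by (rule LIMSEQ_ignore_initial_segment)
      qed
      show "AE x in lborel. norm (G (u (\<tau> (n + N)) x) * W (\<tau> (n + N), x))
          \<le> B * indicator (cball 0 r) x" for n
        using C N[of "n + N", simplified]
      proof eventually_elim
        case (elim x)
        then have "\<bar>u (\<tau> (n + N)) x\<bar> \<le> C + 1" by linarith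
        then show ?case using B T by simp
      qed
    qed
    then show "(\<lambda>n. \<integral>x. G (u (\<tau> n) x) * W (\<tau> n, x) \<partial>lborel)
        \<longlonglongrightarrow> (\<integral>x. G (u a x) * W (a, x) \<partial>lborel)"
      by (rule LIMSEQ_offset)
  qed
qed

section \<open>The test function estimate\<close>

text \<open>The slope is the infimum of the difference quotients to the right of a, that is, the
  right derivative. The tangent line at b = 0 gives m a >= h(a) >= 0, hence m >= 0.\<close>

lemma convex_subgradient:
  fixes h :: "real \<Rightarrow> real"
  assumes h: "convex_on {0..} h" and a: "a > 0" and "h 0 = 0" "h a \<ge> 0"
  shows "\<exists>m\<ge>0. \<forall>b\<ge>0. h a + m * (b - a) \<le> h b"
proof -
  define m where "m = Inf ((\<lambda>t. (h a - h t) / (a - t)) ` ({a<..} \<inter> {0..}))"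
  have m: "h a + m * (b - a) \<le> h b" if "b \<ge> 0" for b
    using convex_le_Inf_differential[OF h, of a b] a that
    unfolding m_def by simp
  have "m * a \<ge> 0" using m[of 0] assms by simp
  then have "m \<ge> 0" using a by (simp add: zero_le_mult_iff)
  then show ?thesis using m by blast
qed

section \<open>The nonlinearity and the pointwise tangent inequality\<close>

lemma modulus_of_continuity_mono:
  "modulus_of_continuity \<mu> \<Longrightarrow> 0 \<le> s \<Longrightarrow> s \<le> r \<Longrightarrow> \<mu> s \<le> \<mu> r"
  by (auto simp: modulus_of_continuity_def mono_on_def)

lemma modulus_of_continuity_nonneg: "modulus_of_continuity \<mu> \<Longrightarrow> 0 \<le> s \<Longrightarrow> 0 \<le> \<mu> s"
  by (auto simp: modulus_of_continuity_def)

lemma nonlin_nonneg: "modulus_of_continuity \<mu> \<Longrightarrow> 0 \<le> nonlin n \<mu> v"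
  by (simp add: nonlin_def modulus_of_continuity_nonneg)

lemma continuous_on_nonlin:
  assumes "modulus_of_continuity \<mu>"
  shows "continuous_on UNIV (nonlin n \<mu>)"
proof -
  have "continuous_on {0..} \<mu>"
    using assms by (simp add: modulus_of_continuity_def)
  then have "continuous_on UNIV (\<lambda>v::real. \<mu> \<bar>v\<bar>)"
    by (rule continuous_on_compose2) (auto intro: continuous_intros)
  moreover have "continuous_on UNIV (\<lambda>v::real. \<bar>v\<bar> powr (1 + 2 / real n))"
    by (intro continuous_on_powr' continuous_intros) (auto simp: add_pos_nonneg)
  ultimately show ?thesis
    unfolding nonlin_def[abs_def] by (intro continuous_on_mult)
qed

text \<open>With p = 1 + 2/n, the power p restores w from w^(1/p), and \<open>\<mu>\<close> only
  decreases because w^(1/p) <= 1. This dictates the exponent 1/p in the bound on the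
  adjoint.\<close>

lemma nonlin_damped_le:
  assumes "modulus_of_continuity \<mu>" "0 \<le> w" "w \<le> 1"
  shows "nonlin n \<mu> (\<bar>v\<bar> * w powr (1 / (1 + 2 / real n))) \<le> nonlin n \<mu> v * w"
proof -
  let ?p = "1 + 2 / real n"
  have p: "?p > 0" by (simp add: add_pos_nonneg)
  have le1: "w powr (1 / ?p) \<le> 1"
    using assms p by (intro powr_le1) auto
  have "(\<bar>v\<bar> * w powr (1 / ?p)) powr ?p = \<bar>v\<bar> powr ?p * w"
    using assms p by (simp add: powr_mult powr_powr)
  moreover have "\<mu> (\<bar>v\<bar> * w powr (1 / ?p)) \<le> \<mu> \<bar>v\<bar>"
    using le1 by (intro modulus_of_continuity_mono[OF assms(1)]) (auto simp: mult_left_le)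
  ultimately show ?thesis
    using assms(2) by (simp add: nonlin_def abs_mult mult.assoc mult.commute[of w])
      (intro mult_left_mono mult_right_mono; simp)
qed

text \<open>The quantity I(R) of the overview, as an iterated integral to match the weak formulation
  exactly.\<close>

definition cutoff_mass :: "(real \<Rightarrow> real) \<Rightarrow> (real \<Rightarrow> real^'n \<Rightarrow> real) \<Rightarrow> real \<Rightarrow> real" where
  "cutoff_mass \<mu> u R =
    (LINT t:{0..}|lborel. (LINT x|lborel. nonlin CARD('n) \<mu> (u t x) * scaled_cutoff R (t, x)))"

text \<open>Where the adjoint is nonzero, R/C times the left-hand product is at most b = |v|
  w^(1/p), with w the cutoff. The tangent line at a bounds m b by h(b) + (m a - h(a)), and
  \<open>nonlin_damped_le\<close> bounds h(b) by h(|v|) w. Elsewhere monotonicity of the cutoff in R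
  suffices.\<close>

lemma wave_adjoint_pointwise:
  fixes z :: "real \<times> 'a::euclidean_space"
  assumes mu: "modulus_of_continuity \<mu>"
    and R: "R > 0" and C: "C > 0" and m: "m \<ge> 0"
    and tangent: "\<And>b. b \<ge> 0 \<Longrightarrow> nonlin n \<mu> a + m * (b - a) \<le> nonlin n \<mu> b"
    and bound: "\<bar>wave_adjoint (scaled_cutoff R) z\<bar> \<le> C / R *
      (if parabolic_gauge (rescale R z) \<le> 1 / 2 then 0
       else scaled_cutoff R z powr (1 / (1 + 2 / real n)))"
  shows "m * (R / C) * (v * wave_adjoint (scaled_cutoff R) z) \<le>
    nonlin n \<mu> v * scaled_cutoff R z - nonlin n \<mu> v * scaled_cutoff (R / 2) z
    + (m * a - nonlin n \<mu> a) * (indicator {..R} (fst z) * indicator (cball 0 (sqrt R)) (snd z))"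
proof -
  let ?w = "scaled_cutoff R z" and ?q = "1 / (1 + 2 / real n)"
  \<comment> \<open>The tangent line evaluated at b = 0, where the nonlinearity vanishes.\<close>
  have ma: "m * a - nonlin n \<mu> a \<ge> 0"
    using tangent[of 0] by (simp add: nonlin_def)
  show ?thesis
  proof (cases "parabolic_gauge (rescale R z) \<le> 1 / 2 \<or> ?w = 0")
    case True
    then have "wave_adjoint (scaled_cutoff R) z = 0"
      using bound by (auto split: if_splits)
    moreover have "nonlin n \<mu> v * scaled_cutoff (R / 2) z \<le> nonlin n \<mu> v * ?w"
      using R by (intro mult_left_mono scaled_cutoff_mono nonlin_nonneg[OF mu]) auto
    ultimately show ?thesis using ma by simp
  next
    case False
    define b where "b = \<bar>v\<bar> * ?w powr ?q"
    have half: "scaled_cutoff (R / 2) z = 0"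
      using False R by (intro scaled_cutoff_half) auto
    have ind: "indicator {..R} (fst z) = (1::real)" "indicator (cball 0 (sqrt R)) (snd z) = (1::real)"
      using scaled_cutoff_support[OF R, of "fst z" "snd z"] False by auto
    have "R / C * (v * wave_adjoint (scaled_cutoff R) z) \<le>
        R / C * (\<bar>v\<bar> * \<bar>wave_adjoint (scaled_cutoff R) z\<bar>)"
      using R C by (intro mult_left_mono) (auto simp: abs_mult[symmetric])
    also have "\<dots> \<le> R / C * (\<bar>v\<bar> * (C / R * ?w powr ?q))"
      using bound False R C by (intro mult_left_mono) auto
    also have "\<dots> = b"
      using R C by (simp add: b_def)
    finally have "m * (R / C * (v * wave_adjoint (scaled_cutoff R) z)) \<le> m * b"
      using m by (rule mult_left_mono)
    also have "\<dots> \<le> nonlin n \<mu> b + (m * a - nonlin n \<mu> a)"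
      using tangent[of b] by (simp add: b_def algebra_simps)
    also have "nonlin n \<mu> b \<le> nonlin n \<mu> v * ?w"
      unfolding b_def by (intro nonlin_damped_le mu scaled_cutoff_bounds)
    finally show ?thesis
      by (simp add: half ind mult.assoc)
  qed
qed

text \<open>The pointwise inequality is integrated over x in each time slice and then over t. The
  last factor is the volume of [0, R] times the ball of radius sqrt R. The tangent point
  \<open>a\<close> stays free, to be adapted later to the size of the mass.\<close>

lemma cutoff_mass_estimate:
  fixes \<mu> :: "real \<Rightarrow> real" and g :: "real^'n \<Rightarrow> real"
  assumes mu: "modulus_of_continuity \<mu>"
    and conv: "convex_on {0..} (\<lambda>s. s powr (1 + 2 / real CARD('n)) * \<mu> s)"
    and sol: "global_sobolev_solution \<mu> g u"
  shows "\<exists>C>0. \<forall>R\<ge>1. \<forall>a>0. \<exists>m\<ge>0.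
    m * (R / C * (cutoff_mass \<mu> u R + (LINT x|lborel. g x * scaled_cutoff R (0, x)))) \<le>
    cutoff_mass \<mu> u R - cutoff_mass \<mu> u (R / 2)
    + (m * a - nonlin CARD('n) \<mu> a) * (R * measure lborel (cball (0::real^'n) (sqrt R)))"
proof -
  let ?n = "CARD('n)" and ?q = "1 / (1 + 2 / real CARD('n))"
  let ?N = "nonlin CARD('n) \<mu>"
  have "?q < 1" by (simp add: field_simps)
  then obtain C where C: "C > 0" "\<And>R z. R \<ge> 1 \<Longrightarrow>
      \<bar>wave_adjoint (scaled_cutoff R) z\<bar> \<le> C / R *
      (if parabolic_gauge (rescale R z) \<le> 1 / 2 then 0
       else scaled_cutoff R (z :: real \<times> (real^'n)) powr ?q)"
    using wave_adjoint_scaled_cutoff_bound by blast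
  have Linf: "Linf (u t)" if "t \<ge> 0" for t
    using sol that by (simp add: global_sobolev_solution_def)
  have cont: "\<exists>\<delta>>0. \<forall>t\<ge>0. \<bar>t - t0\<bar> < \<delta> \<longrightarrow> (AE x in lborel. \<bar>u t x - u t0 x\<bar> \<le> \<epsilon>)"
    if "t0 \<ge> 0" "\<epsilon> > 0" for t0 \<epsilon>
    using sol that unfolding global_sobolev_solution_def by meson
  have "\<exists>m\<ge>0. m * (R / C * (cutoff_mass \<mu> u R + (LINT x|lborel. g x * scaled_cutoff R (0, x)))) \<le>
      cutoff_mass \<mu> u R - cutoff_mass \<mu> u (R / 2)
      + (m * a - ?N a) * (R * measure lborel (cball (0::real^'n) (sqrt R)))"
    if R: "R \<ge> 1" and a: "a > 0" for R a
  proof -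
    define V where "V = measure lborel (cball (0::real^'n) (sqrt R))"
    let ?\<Phi> = "wave_adjoint (scaled_cutoff R) :: real \<times> (real^'n) \<Rightarrow> real"
    have N_pos: "?N s = s powr (1 + 2 / real ?n) * \<mu> s" if "s \<ge> 0" for s
      using that by (simp add: nonlin_def)
    obtain m where m: "m \<ge> 0" "\<And>b. b \<ge> 0 \<Longrightarrow> ?N a + m * (b - a) \<le> ?N b"
      using convex_subgradient[OF conv a] a modulus_of_continuity_nonneg[OF mu, of a]
      by (auto simp: N_pos)
    \<comment> \<open>The bound contains a power of the cutoff, so the adjoint inherits its compact
      support.\<close>
    have \<Phi>0: "?\<Phi> (t, x) = 0" if "scaled_cutoff R (t, x) = 0" for t x
      using C(2)[OF R, of "(t, x)"] that by (simp split: if_splits)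
    have \<Phi>_x: "?\<Phi> (t, x) = 0" if "norm x > sqrt R" for t x
      using scaled_cutoff_support(2)[of R t x] R that by (intro \<Phi>0) fastforce
    have \<Phi>_t: "?\<Phi> (t, x) = 0" if "t > R" for t x
      using scaled_cutoff_support(1)[of R t x] R that by (intro \<Phi>0) fastforce
    have \<psi>_x: "scaled_cutoff S (t, x) = 0" if "norm x > sqrt S" "S > 0"
      for S t and x :: "real^'n"
      using scaled_cutoff_support(2)[of S t x] that by fastforce
    have \<psi>_t: "scaled_cutoff S (t, x) = 0" if "t > S" "S > 0" for S t and x :: "real^'n"
      using scaled_cutoff_support(1)[of S t x] that by fastforce
    have \<psi>_cont: "continuous_on UNIV (scaled_cutoff S :: real \<times> (real^'n) \<Rightarrow> real)" for S
      by (intro smooth_term_continuous smooth_term_scaled_cutoff)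
    have \<Phi>_cont: "continuous_on UNIV ?\<Phi>"
      by (intro continuous_wave_adjoint smooth_term_scaled_cutoff)
    define F where "F = (\<lambda>t. LINT x|lborel. u t x * ?\<Phi> (t, x))"
    define H where "H = (\<lambda>S t. LINT x|lborel. ?N (u t x) * scaled_cutoff S (t, x))"
    have int_F: "integrable lborel (\<lambda>x. u t x * ?\<Phi> (t, x))" if "t \<ge> 0" for t
      using integrable_slice[of u "\<lambda>v. v", OF Linf cont continuous_on_id \<Phi>_cont \<Phi>_x that] .
    have int_H: "integrable lborel (\<lambda>x. ?N (u t x) * scaled_cutoff S (t, x))"
      if "t \<ge> 0" "S > 0" for t S
      using integrable_slice[of u, OF Linf cont continuous_on_nonlin[OF mu] \<psi>_cont \<psi>_x that(1)]
        that(2) by blast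
    have F_int: "set_integrable lborel {0..} F"
    proof (rule set_integrable_continuous_vanishing)
      show "continuous_on {0..} F"
        unfolding F_def
        using continuous_on_slice_integral[of u "\<lambda>v. v", OF Linf cont continuous_on_id \<Phi>_cont \<Phi>_x] .
      show "F t = 0" if "t > R" for t
        using \<Phi>_t[OF that] by (simp add: F_def)
    qed
    have H_int: "set_integrable lborel {0..} (H S)" if "S > 0" for S
    proof (rule set_integrable_continuous_vanishing)
      show "continuous_on {0..} (H S)"
        unfolding H_def
        using continuous_on_slice_integral[of u, OF Linf cont continuous_on_nonlin[OF mu] \<psi>_cont \<psi>_x]
          that by blast
      show "H S t = 0" if "t > S" for t
        using \<psi>_t[OF that \<open>S > 0\<close>] by (simp add: H_def)
    qed
    have ball_int: "integrable lborel (\<lambda>x::real^'n. c * (d * indicator (cball 0 (sqrt R)) x))"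
      for c d :: real
      by (intro integrable_mult_right integrable_real_indicator)
        (auto intro: emeasure_bounded_finite[simplified])
    have slice: "m * (R / C) * F t \<le> H R t - H (R / 2) t + (m * a - ?N a) * V * indicator {..R} t"
      if t: "t \<ge> 0" for t
    proof -
      have "m * (R / C) * F t = (LINT x|lborel. m * (R / C) * (u t x * ?\<Phi> (t, x)))"
        unfolding F_def by simp
      also have "\<dots> \<le> (LINT x|lborel. ?N (u t x) * scaled_cutoff R (t, x)
          - ?N (u t x) * scaled_cutoff (R / 2) (t, x)
          + (m * a - ?N a) * (indicator {..R} t * indicator (cball 0 (sqrt R)) x))"
      proof (rule integral_mono)
        show "integrable lborel (\<lambda>x. m * (R / C) * (u t x * ?\<Phi> (t, x)))"
          by (intro integrable_mult_right int_F t)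
        show "integrable lborel (\<lambda>x. ?N (u t x) * scaled_cutoff R (t, x)
          - ?N (u t x) * scaled_cutoff (R / 2) (t, x)
          + (m * a - ?N a) * (indicator {..R} t * indicator (cball 0 (sqrt R)) x))"
          using R by (intro Bochner_Integration.integrable_add Bochner_Integration.integrable_diff
              int_H t ball_int) auto
        show "m * (R / C) * (u t x * ?\<Phi> (t, x)) \<le> ?N (u t x) * scaled_cutoff R (t, x)
          - ?N (u t x) * scaled_cutoff (R / 2) (t, x)
          + (m * a - ?N a) * (indicator {..R} t * indicator (cball 0 (sqrt R)) x)" for x
          using wave_adjoint_pointwise[OF mu _ C(1) m C(2)[OF R, of "(t, x)"], of "u t x"] R
          by simp
      qed
      also have "\<dots> = H R t - H (R / 2) t + (m * a - ?N a) * V * indicator {..R} t"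
      proof -
        have 1: "integrable lborel (\<lambda>x. ?N (u t x) * scaled_cutoff R (t, x))"
          "integrable lborel (\<lambda>x. ?N (u t x) * scaled_cutoff (R / 2) (t, x))"
          using R by (auto intro!: int_H t)
        have "(LINT x|lborel. (m * a - ?N a) * (indicator {..R} t * indicator (cball 0 (sqrt R)) (x :: real^'n))) =
            (m * a - ?N a) * V * indicator {..R} t"
          by (simp add: V_def)
        then show ?thesis
          unfolding Bochner_Integration.integral_add[OF Bochner_Integration.integrable_diff[OF 1] ball_int]
            Bochner_Integration.integral_diff[OF 1] H_def by simp
      qed
      finally show ?thesis .
    qed
    have ind_eq: "(\<lambda>t. indicator {0..} t *\<^sub>R ((m * a - ?N a) * V * indicator {..R} t)) =
        (\<lambda>t. ((m * a - ?N a) * V) * indicator {0..R} t)"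
      by (auto simp: indicator_def)
    have ind_int: "set_integrable lborel {0..} (\<lambda>t. (m * a - ?N a) * V * indicator {..R} t)"
      unfolding set_integrable_def ind_eq
      by (intro integrable_mult_right integrable_real_indicator)
        (auto simp: emeasure_lborel_Icc_eq)
    have ind_val: "(LINT t:{0..}|lborel. (m * a - ?N a) * V * indicator {..R} t) =
        (m * a - ?N a) * (R * V)"
      unfolding set_lebesgue_integral_def ind_eq using R by simp
    have "m * (R / C) * (LINT t:{0..}|lborel. F t) = (LINT t:{0..}|lborel. m * (R / C) * F t)"
      by simp
    also have "\<dots> \<le> (LINT t:{0..}|lborel. H R t - H (R / 2) t
        + (m * a - ?N a) * V * indicator {..R} t)"
      using slice R
      by (intro set_integral_mono set_integral_add(1) set_integral_diff(1) H_int ind_int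
          set_integrable_mult_right F_int) auto
    also have "\<dots> = cutoff_mass \<mu> u R - cutoff_mass \<mu> u (R / 2) + (m * a - ?N a) * (R * V)"
    proof -
      have 1: "set_integrable lborel {0..} (H R)" "set_integrable lborel {0..} (H (R / 2))"
        using R by (auto intro!: H_int)
      show ?thesis
        unfolding set_integral_add(2)[OF set_integral_diff(1)[OF 1] ind_int]
          set_integral_diff(2)[OF 1] ind_val
        by (simp only: cutoff_mass_def H_def)
    qed
    \<comment> \<open>The weak formulation tested with \<open>scaled_cutoff R\<close>.\<close>
    also have "(LINT t:{0..}|lborel. F t) =
        cutoff_mass \<mu> u R + (LINT x|lborel. g x * scaled_cutoff R (0, x))"
    proof -
      have "test_fun (scaled_cutoff R :: real \<times> (real^'n) \<Rightarrow> real)"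
        using R by (intro test_fun_scaled_cutoff) simp
      then show ?thesis
        using sol unfolding global_sobolev_solution_def F_def wave_adjoint_def cutoff_mass_def
        by blast
    qed
    finally show ?thesis
      using m(1) unfolding V_def mult.assoc by blast
  qed
  then show ?thesis using C(1) by blast
qed

section \<open>Summation over dyadic scales\<close>

text \<open>Dominated convergence with majorant |g|: for fixed x the rescaled points tend to 0. The
  plateau value \<open>cutoff 0\<close> is not normalised to 1, so it remains as a positive
  factor.\<close>

lemma tendsto_integral_scaled_cutoff:
  fixes g :: "'a::euclidean_space \<Rightarrow> real"
  assumes g: "integrable lborel g"
  shows "(\<lambda>K. LINT x|lborel. g x * scaled_cutoff (2 ^ K) (0, x))
    \<longlonglongrightarrow> (LINT x|lborel. g x * cutoff (0 :: real \<times> 'a))"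
proof (rule integral_dominated_convergence[where w = "\<lambda>x. norm (g x)"])
  have meas: "(\<lambda>x. scaled_cutoff R (0, x :: 'a)) \<in> borel_measurable lborel" for R
    unfolding measurable_lborel2
    by (intro borel_measurable_continuous_onI
        continuous_on_compose2[OF smooth_term_continuous[OF smooth_term_scaled_cutoff, of UNIV]]
        continuous_intros) auto
  show "(\<lambda>x. g x * scaled_cutoff (2 ^ K) (0, x)) \<in> borel_measurable lborel" for K
    by (intro borel_measurable_times meas borel_measurable_integrable g)
  show "(\<lambda>x. g x * cutoff (0 :: real \<times> 'a)) \<in> borel_measurable lborel"
    by (intro borel_measurable_times borel_measurable_const borel_measurable_integrable g)
  show "integrable lborel (\<lambda>x. norm (g x))" using g by simp
  show "AE x in lborel. (\<lambda>K. g x * scaled_cutoff (2 ^ K) (0, x)) \<longlonglongrightarrow> g x * cutoff (0 :: real \<times> 'a)"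
  proof (rule AE_I2, rule tendsto_mult_left)
    fix x :: 'a
    have "(\<lambda>K. sqrt ((1 / 2) ^ K)) \<longlonglongrightarrow> sqrt 0"
      by (intro tendsto_real_sqrt LIMSEQ_power_zero) simp
    then have "(\<lambda>K. sqrt ((1 / 2) ^ K) *\<^sub>R x) \<longlonglongrightarrow> 0 *\<^sub>R x"
      by (intro tendsto_scaleR tendsto_const) simp
    then have "(\<lambda>K. (0 :: real, sqrt ((1 / 2) ^ K) *\<^sub>R x)) \<longlonglongrightarrow> (0, 0)"
      by (intro tendsto_Pair tendsto_const) simp
    then have "(\<lambda>K. cutoff (0 :: real, sqrt ((1 / 2) ^ K) *\<^sub>R x)) \<longlonglongrightarrow> cutoff (0 :: real, 0 :: 'a)"
      by (rule continuous_on_tendsto_compose[OF smooth_term_continuous[OF smooth_term_cutoff, of UNIV]]) auto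
    then show "(\<lambda>K. scaled_cutoff (2 ^ K) (0, x)) \<longlonglongrightarrow> cutoff (0 :: real \<times> 'a)"
      by (simp add: scaled_cutoff_def rescale_def zero_prod_def power_one_over real_sqrt_divide
          inverse_eq_divide)
  qed
  show "AE x in lborel. norm (g x * scaled_cutoff (2 ^ K) (0, x)) \<le> norm (g x)" for K
    by (rule AE_I2) (simp add: abs_mult scaled_cutoff_bounds mult_left_le)
qed

text \<open>Comparison of a rectangle with the integral of t^(-1-q) over [x, y], done by the mean
  value theorem for t^(-q).\<close>

lemma diff_div_powr_le:
  fixes x y q :: real
  assumes "0 < x" "x \<le> y" "q > 0"
  shows "(y - x) / y powr (1 + q) \<le> (x powr - q - y powr - q) / q"
proof (cases "x = y")
  case False
  have "((\<lambda>t. t powr - q) has_real_derivative - q * t powr (- q - 1)) (at t)" if "x \<le> t" for t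
    using assms that by (intro has_real_derivative_powr) auto
  then obtain z where z: "x < z" "z < y" "y powr - q - x powr - q = (y - x) * (- q * z powr (- q - 1))"
    using MVT2[of x y "\<lambda>t. t powr - q" "\<lambda>t. - q * t powr (- q - 1)"] False assms by auto
  have "y powr (- q - 1) \<le> z powr (- q - 1)"
    using z assms by (intro powr_mono2') auto
  then have "(y - x) * y powr (- q - 1) \<le> (y - x) * z powr (- q - 1)"
    using z by (intro mult_left_mono) auto
  also have "\<dots> = (x powr - q - y powr - q) / q"
    using z(3) assms by (simp add: field_simps)
  also have "- q - 1 = - (1 + q)" by simp
  finally show ?thesis by (simp only: powr_minus_divide times_divide_eq_right mult_1_right)
qed simp

text \<open>The previous comparison telescopes. The bound depends on neither \<open>N\<close> nor
  the growth of \<open>y\<close>, so no a priori bound on the masses is required.\<close>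

lemma sum_diff_div_powr_le:
  fixes y :: "nat \<Rightarrow> real"
  assumes "\<And>k. 0 < y k" "\<And>k. y k \<le> y (Suc k)" "q > 0"
  shows "(\<Sum>k<N. (y (Suc k) - y k) / y (Suc k) powr (1 + q)) \<le> y 0 powr - q / q"
proof -
  have "(\<Sum>k<N. (y (Suc k) - y k) / y (Suc k) powr (1 + q)) \<le>
      (\<Sum>k<N. y k powr - q / q - y (Suc k) powr - q / q)"
    using diff_div_powr_le[OF assms(1,2,3)] by (intro sum_mono) (simp add: diff_divide_distrib)
  also have "\<dots> = y 0 powr - q / q - y N powr - q / q"
    by (rule sum_lessThan_telescope')
  also have "\<dots> \<le> y 0 powr - q / q"
    using assms by simp
  finally show ?thesis .
qed

text \<open>Integral test on geometric intervals: \<open>\<mu> (1 / s) / s\<close> is at most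
  \<open>c k\<close> on \<open>?I k\<close>, and \<open>c k\<close> times the length of
  \<open>?I k\<close> is \<open>\<mu> (d / \<rho> ^ k)\<close> times \<rho> - 1. The range from
  \<open>C0\<close> to \<open>1 / d\<close> is bounded and contributes a finite amount.\<close>

lemma modulus_integral_finite:
  assumes mu: "modulus_of_continuity \<mu>" and \<rho>: "\<rho> > 1" and d: "d > 0" and C0: "C0 > 0"
    and bdd: "\<And>N. (\<Sum>k<N. \<mu> (d / \<rho> ^ k)) \<le> M"
  shows "(\<integral>\<^sup>+s. ennreal (indicator {C0..} s * (\<mu> (1 / s) / s)) \<partial>lborel) < \<infinity>"
proof -
  \<comment> \<open>The value of the integrand at the left endpoint of \<open>?I k\<close>.\<close>
  define c where "c k = \<mu> (d / \<rho> ^ k) / (\<rho> ^ k / d)" for k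
  define A where "A = \<mu> (1 / C0) / C0"
  let ?I = "\<lambda>k. {\<rho> ^ k / d..\<rho> ^ Suc k / d}"
  have mu0: "\<mu> s \<ge> 0" if "s \<ge> 0" for s
    using mu that by (rule modulus_of_continuity_nonneg)
  have c0: "c k \<ge> 0" for k
    unfolding c_def using \<rho> d by (intro divide_nonneg_nonneg mu0) auto
  have A0: "A \<ge> 0" using C0 by (auto simp: A_def intro!: divide_nonneg_nonneg mu0)
  have pw: "ennreal (indicator {C0..} s * (\<mu> (1 / s) / s)) \<le>
      ennreal A * indicator {C0..1 / d} s + (\<Sum>k. ennreal (c k) * indicator (?I k) s)" for s
  proof -
    consider "s < C0" | "s \<ge> C0" "s \<le> 1 / d" | "s \<ge> C0" "s > 1 / d" by linarith
    then show ?thesis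
    proof cases
      case 2
      have "\<mu> (1 / s) \<le> \<mu> (1 / C0)"
        using 2 C0 by (intro modulus_of_continuity_mono[OF mu] divide_left_mono) auto
      then have "\<mu> (1 / s) / s \<le> A"
        unfolding A_def using 2 C0 by (intro frac_le mu0) auto
      then have "ennreal (indicator {C0..} s * (\<mu> (1 / s) / s)) \<le> ennreal A * indicator {C0..1 / d} s"
        using 2 by (simp add: ennreal_leI)
      then show ?thesis by (rule order_trans) simp
    next
      case 3
      have sd: "s * d > 1" using 3 d by (simp add: field_simps)
      obtain N where N: "s * d < \<rho> ^ N" using real_arch_pow[OF \<rho>] by blast
      \<comment> \<open>Minimality puts s into \<open>?I k\<close>; for k = 0 the lower bound comes
        from s d > 1 instead.\<close>
      define k where "k = (LEAST k. s * d < \<rho> ^ Suc k)"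
      have ex: "s * d < \<rho> ^ Suc N" using N \<rho> power_increasing[of N "Suc N" \<rho>] by linarith
      have k1: "s * d < \<rho> ^ Suc k"
        unfolding k_def by (rule LeastI[of _ N]) (rule ex)
      have k2: "\<rho> ^ k \<le> s * d"
      proof (cases k)
        case (Suc j)
        then have "\<not> s * d < \<rho> ^ Suc j"
          using not_less_Least[of j "\<lambda>k. s * d < \<rho> ^ Suc k"] by (simp add: k_def)
        then show ?thesis using Suc by simp
      qed (use sd in simp)
      have s_in: "s \<in> ?I k"
        using k1 k2 d by (simp add: divide_le_eq le_divide_eq less_imp_le)
      have pos: "\<rho> ^ k / d > 0" using \<rho> d by simp
      have "1 / s \<le> d / \<rho> ^ k"
        using k2 \<rho> d 3 C0 by (simp add: field_simps)
      then have "\<mu> (1 / s) \<le> \<mu> (d / \<rho> ^ k)"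
        using 3 C0 by (intro modulus_of_continuity_mono[OF mu]) auto
      moreover have "\<rho> ^ k / d \<le> s" using s_in by simp
      ultimately have "\<mu> (1 / s) / s \<le> c k"
        unfolding c_def using pos \<rho> d by (intro frac_le mu0) auto
      then have "ennreal (indicator {C0..} s * (\<mu> (1 / s) / s)) \<le> ennreal (c k) * indicator (?I k) s"
        using 3 s_in by (simp add: ennreal_leI)
      also have "\<dots> \<le> (\<Sum>k. ennreal (c k) * indicator (?I k) s)"
      proof -
        define f where "f = (\<lambda>j. ennreal (c j) * indicator (?I j) s)"
        have "f k \<le> suminf f"
          using sum_le_suminf[of f "{k}"] by (simp add: summableI)
        then show ?thesis by (simp only: f_def)
      qed
      finally show ?thesis by (rule order_trans) simp
    qed simp
  qed
  have "(\<integral>\<^sup>+s. ennreal (indicator {C0..} s * (\<mu> (1 / s) / s)) \<partial>lborel) \<le>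
      (\<integral>\<^sup>+s. ennreal A * indicator {C0..1 / d} s + (\<Sum>k. ennreal (c k) * indicator (?I k) s) \<partial>lborel)"
    by (intro nn_integral_mono pw)
  also have "\<dots> = ennreal A * emeasure lborel {C0..1 / d}
      + (\<Sum>k. ennreal (c k) * emeasure lborel (?I k))"
    by (simp add: nn_integral_add nn_integral_suminf nn_integral_cmult_indicator)
  also have "(\<Sum>k. ennreal (c k) * emeasure lborel (?I k)) \<le> ennreal (M * (\<rho> - 1))"
  proof (rule suminf_le_const[OF summableI])
    fix N
    have summand: "ennreal (c k) * emeasure lborel (?I k) = ennreal (\<mu> (d / \<rho> ^ k) * (\<rho> - 1))" for k
    proof -
      have "\<rho> ^ k / d \<le> \<rho> ^ Suc k / d"
        using \<rho> d by (intro divide_right_mono) auto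
      then have "ennreal (c k) * emeasure lborel (?I k) =
          ennreal (c k * (\<rho> ^ Suc k / d - \<rho> ^ k / d))"
        using c0 by (simp add: ennreal_mult)
      also have "c k * (\<rho> ^ Suc k / d - \<rho> ^ k / d) = \<mu> (d / \<rho> ^ k) * (\<rho> - 1)"
        using \<rho> d by (simp add: c_def field_simps)
      finally show ?thesis .
    qed
    have "(\<Sum>k<N. ennreal (c k) * emeasure lborel (?I k)) =
        ennreal ((\<Sum>k<N. \<mu> (d / \<rho> ^ k)) * (\<rho> - 1))"
      unfolding summand sum_distrib_right
      using \<rho> d by (intro sum_ennreal mult_nonneg_nonneg mu0) auto
    also have "\<dots> \<le> ennreal (M * (\<rho> - 1))"
      using bdd[of N] \<rho> by (intro ennreal_leI mult_right_mono) auto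
    finally show "(\<Sum>k<N. ennreal (c k) * emeasure lborel (?I k)) \<le> ennreal (M * (\<rho> - 1))" .
  qed
  also have "ennreal A * emeasure lborel {C0..1 / d} + ennreal (M * (\<rho> - 1)) < \<infinity>"
    by (simp add: ennreal_mult_less_top emeasure_lborel_Icc_eq)
  finally show ?thesis by (simp add: add_left_mono)
qed

text \<open>The choice of \<open>a\<close> makes the terms containing the unknown slope m cancel,
  leaving h(a) R V <= D with h the nonlinearity. Since the exponent 2/n is critical, all powers of R
  then cancel except inside \<open>\<mu>\<close>.\<close>

lemma modulus_step:
  assumes mu: "modulus_of_continuity \<mu>" and C: "C > 0" and R: "R > 0" and c: "c > 0" and y: "y \<ge> c"
    and Z: "Z \<ge> y" and n: "n > 0"
    and \<omega>: "\<omega> > 0" and V: "V = \<omega> * sqrt R ^ n"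
    and est: "\<And>a. a > 0 \<Longrightarrow> \<exists>m\<ge>0. m * (R / C * Z) \<le> D + (m * a - nonlin n \<mu> a) * (R * V)"
  shows "0 \<le> D" and "\<mu> (c / (C * \<omega>) / sqrt R ^ n) \<le>
    C * (C * \<omega>) powr (2 / n) * (D / y powr (1 + 2 / n))"
proof -
  \<comment> \<open>Chosen so that a R V = (R / C) y, which \<open>Z \<ge> y\<close> compares with
    the left-hand side of \<open>est\<close>.\<close>
  define a where "a = y / (C * V)"
  have V0: "V > 0" using \<omega> R V by simp
  have y0: "y > 0" using c y by simp
  have a0: "a > 0" using C V0 y0 by (simp add: a_def)
  obtain m where m: "m \<ge> 0" "m * (R / C * Z) \<le> D + (m * a - nonlin n \<mu> a) * (R * V)"
    using est[OF a0] by blast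
  have aRV: "a * (R * V) = R / C * y"
    using C V0 by (simp add: a_def field_simps)
  have "m * (R / C * y) \<le> m * (R / C * Z)"
    using m(1) R C Z by (intro mult_left_mono) auto
  also have "\<dots> \<le> D + m * (R / C * y) - nonlin n \<mu> a * (R * V)"
  proof -
    have "(m * a - nonlin n \<mu> a) * (R * V) = m * (a * (R * V)) - nonlin n \<mu> a * (R * V)"
      by (simp only: left_diff_distrib mult.assoc)
    then show ?thesis using m(2) unfolding aRV by linarith
  qed
  finally have D: "nonlin n \<mu> a * (R * V) \<le> D" by simp
  then show "0 \<le> D"
    using nonlin_nonneg[OF mu, of n a] R V0 by (meson mult_nonneg_nonneg less_imp_le order_trans)
  \<comment> \<open>Criticality: the volume of the ball to the power 2/n is a multiple of R.\<close>
  have "(sqrt R ^ n) powr (2 / n) = R"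
  proof -
    have "sqrt R ^ n = R powr (n / 2)"
      using R by (simp add: powr_half_sqrt[symmetric] powr_realpow[symmetric] powr_powr)
    then show ?thesis using R n by (simp add: powr_powr)
  qed
  then have a_pow: "a powr (2 / n) * (C * \<omega>) powr (2 / n) * R = y powr (2 / n)"
    using C \<omega> R y0 V by (simp add: a_def powr_divide powr_mult)
  have "nonlin n \<mu> a * (R * V) = a powr (2 / n) * \<mu> a * (a * (R * V))"
    using a0 by (simp add: nonlin_def powr_add)
  then have "a powr (2 / n) * \<mu> a * (R / C * y) \<le> D"
    using D unfolding aRV by simp
  then have "C * (C * \<omega>) powr (2 / n) * (a powr (2 / n) * \<mu> a * (R / C * y)) \<le>
      C * (C * \<omega>) powr (2 / n) * D"
    using C by (intro mult_left_mono) auto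
  also have "C * (C * \<omega>) powr (2 / n) * (a powr (2 / n) * \<mu> a * (R / C * y)) =
      (a powr (2 / n) * (C * \<omega>) powr (2 / n) * R) * y * \<mu> a"
    using C by simp
  also have "\<dots> = y powr (1 + 2 / n) * \<mu> a"
    unfolding a_pow using y0 by (simp add: powr_add)
  finally have "\<mu> a \<le> C * (C * \<omega>) powr (2 / n) * (D / y powr (1 + 2 / n))"
    using y0 by (simp add: field_simps)
  \<comment> \<open>Replacing y by its lower bound c gives an argument that depends on the scale
    alone, not on the solution.\<close>
  moreover have "\<mu> (c / (C * \<omega>) / sqrt R ^ n) \<le> \<mu> a"
    unfolding a_def V using c y C \<omega> R
    by (intro modulus_of_continuity_mono[OF mu]) (auto simp: divide_right_mono mult.assoc)
  ultimately show "\<mu> (c / (C * \<omega>) / sqrt R ^ n) \<le>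
      C * (C * \<omega>) powr (2 / n) * (D / y powr (1 + 2 / n))"
    by linarith
qed

section \<open>Contradiction by summing over the scales\<close>

lemma cutoff_mass_nonneg: "modulus_of_continuity \<mu> \<Longrightarrow> 0 \<le> cutoff_mass \<mu> u R"
  unfolding cutoff_mass_def set_lebesgue_integral_def
  by (intro Bochner_Integration.integral_nonneg scaleR_nonneg_nonneg mult_nonneg_nonneg
      nonlin_nonneg scaled_cutoff_bounds) auto

theorem theorem2:
  fixes \<mu> :: "real \<Rightarrow> real" and g :: "real^'n \<Rightarrow> real"
  assumes "modulus_of_continuity \<mu>"
    and "\<exists>C0>0. (\<integral>\<^sup>+s. ennreal (indicator {C0..} s * (\<mu> (1 / s) / s)) \<partial>lborel) = \<infinity>"
    and "convex_on {0..} (\<lambda>s. s powr (1 + 2 / real CARD('n)) * \<mu> s)"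
    and "sobolev_H (nat \<lfloor>real CARD('n) / 2\<rfloor>) g"
    and "integrable lborel g"
    and "(\<integral>x. g x \<partial>lborel) > 0"
  shows "\<not> (\<exists>u. global_sobolev_solution \<mu> g u)"
proof
  assume "\<exists>u. global_sobolev_solution \<mu> g u"
  then obtain u where u: "global_sobolev_solution \<mu> g u" ..
  note mu = assms(1)
  let ?n = "CARD('n)"
  let ?G = "\<lambda>R. LINT x|lborel. g x * scaled_cutoff R (0, x)"
  obtain C where C: "C > 0" and est: "\<And>R a. R \<ge> 1 \<Longrightarrow> a > 0 \<Longrightarrow> \<exists>m\<ge>0.
      m * (R / C * (cutoff_mass \<mu> u R + ?G R)) \<le>
      cutoff_mass \<mu> u R - cutoff_mass \<mu> u (R / 2)
      + (m * a - nonlin ?n \<mu> a) * (R * measure lborel (cball (0::real^'n) (sqrt R)))"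
    using cutoff_mass_estimate[OF mu assms(3) u] by blast
  define \<omega> where "\<omega> = unit_ball_vol (real ?n)"
  have \<omega>: "\<omega> > 0" by (simp add: \<omega>_def)
  have ball: "measure lborel (cball (0::real^'n) (sqrt R)) = \<omega> * sqrt R ^ ?n" if "R \<ge> 1" for R
    using content_cball[of "sqrt R" "0 :: real^'n"] that by (simp add: \<omega>_def)
  \<comment> \<open>Half of the limit of the data term, so that the data term eventually exceeds
    \<open>c\<close>.\<close>
  define c where "c = cutoff (0 :: real \<times> (real^'n)) * (LINT x|lborel. g x) / 2"
  have c: "c > 0"
    unfolding c_def by (intro divide_pos_pos mult_pos_pos cutoff_zero_pos assms(6)) simp
  have "(\<lambda>K. ?G (2 ^ K)) \<longlonglongrightarrow> 2 * c"
    using tendsto_integral_scaled_cutoff[OF assms(5)] by (simp add: c_def mult.commute)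
  then have "\<forall>\<^sub>F K in sequentially. c < ?G (2 ^ K)"
    using c by (intro order_tendstoD(1)) auto
  then obtain K0 where K0: "\<And>K. K \<ge> K0 \<Longrightarrow> c < ?G (2 ^ K)"
    unfolding eventually_sequentially by blast
  \<comment> \<open>The shift by \<open>K0\<close> starts at a scale from which the data term
    exceeds \<open>c\<close>.\<close>
  define y where "y k = cutoff_mass \<mu> u (2 ^ (k + K0)) + c" for k
  have y_ge: "y k \<ge> c" for k
    using cutoff_mass_nonneg[OF mu] by (simp add: y_def)
  define A where "A = C * (C * \<omega>) powr (2 / ?n)"
  have A: "A \<ge> 0" using C by (simp add: A_def)
  \<comment> \<open>The factor by which R^(n/2) grows when R doubles.\<close>
  define \<rho> where "\<rho> = sqrt 2 ^ ?n"
  have \<rho>: "\<rho> > 1" by (simp add: \<rho>_def one_less_power)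
  \<comment> \<open>The step from \<open>y k\<close> to \<open>y (Suc k)\<close> uses the larger
    scale \<open>2 ^ (Suc k + K0)\<close>; hence \<open>Suc K0\<close> rather than
    \<open>K0\<close>.\<close>
  define d where "d = c / (C * \<omega>) / \<rho> ^ Suc K0"
  have d: "d > 0" using c C \<omega> \<rho> by (simp add: d_def)
  have step: "y k \<le> y (Suc k)"
    "\<mu> (d / \<rho> ^ k) \<le> A * ((y (Suc k) - y k) / y (Suc k) powr (1 + 2 / ?n))" for k
  proof -
    define R :: real where "R = 2 ^ (Suc k + K0)"
    have R: "R \<ge> 1" unfolding R_def by (rule one_le_power) simp
    have half: "R / 2 = 2 ^ (k + K0)" by (simp add: R_def)
    have diff: "y (Suc k) - y k = cutoff_mass \<mu> u R - cutoff_mass \<mu> u (R / 2)"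
      unfolding y_def half R_def by simp
    have est': "\<exists>m\<ge>0. m * (R / C * (cutoff_mass \<mu> u R + ?G R)) \<le> y (Suc k) - y k
        + (m * a - nonlin ?n \<mu> a) * (R * (\<omega> * sqrt R ^ ?n))" if "a > 0" for a
      using est[OF R that] unfolding diff ball[OF R] .
    have Z: "y (Suc k) \<le> cutoff_mass \<mu> u R + ?G R"
      using K0[of "Suc k + K0"] by (simp add: y_def R_def)
    have "sqrt R ^ ?n = \<rho> ^ (Suc k + K0)"
      unfolding R_def \<rho>_def real_sqrt_power power_mult[symmetric] by (simp only: mult.commute)
    moreover have "Suc k + K0 = Suc K0 + k" by simp
    ultimately have arg: "c / (C * \<omega>) / sqrt R ^ ?n = d / \<rho> ^ k"
      by (simp only: d_def power_add divide_divide_eq_left)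
    have R0: "R > 0" and n0: "?n > 0" using R by auto
    note * = modulus_step[OF mu C R0 c y_ge Z n0 \<omega> refl est']
    show "y k \<le> y (Suc k)" using *(1) by simp
    show "\<mu> (d / \<rho> ^ k) \<le> A * ((y (Suc k) - y k) / y (Suc k) powr (1 + 2 / ?n))"
      using *(2) unfolding arg A_def .
  qed
  have bdd: "(\<Sum>k<N. \<mu> (d / \<rho> ^ k)) \<le> A * (y 0 powr - (2 / ?n) / (2 / ?n))" for N
  proof -
    have "(\<Sum>k<N. \<mu> (d / \<rho> ^ k)) \<le> A * (\<Sum>k<N. (y (Suc k) - y k) / y (Suc k) powr (1 + 2 / ?n))"
      unfolding sum_distrib_left by (intro sum_mono step(2))
    also have "\<dots> \<le> A * (y 0 powr - (2 / ?n) / (2 / ?n))"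
      by (intro mult_left_mono sum_diff_div_powr_le A step(1) less_le_trans[OF c y_ge]) simp
    finally show ?thesis .
  qed
  obtain C0 where "C0 > 0"
    and "(\<integral>\<^sup>+s. ennreal (indicator {C0..} s * (\<mu> (1 / s) / s)) \<partial>lborel) = \<infinity>"
    using assms(2) by blast
  \<comment> \<open>Bounded partial sums make the integral finite for every positive lower limit, in
    particular for the one where it was assumed infinite.\<close>
  with modulus_integral_finite[OF mu \<rho> d _ bdd] show False
    by fastforce
qed

end
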